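(* I. Up to equivalence, all regular normal extensions for $\mathfrak{so}(3)/\mathfrak{so}(2)$ (the case $c=1$) to $\mathfrak{su}(2,1)$ are given by the following one-parameter class with parameter $s\geq 2$, where $t=\sqrt{\frac{s+\sqrt{s^2-4}}{2}}$: $$\alpha(e,x_1,x_2)=\left(\begin{array}{ccc}\frac{1+t^4}{8t^2}ie & * & \frac{-(15t^8-34t^4+15)}{128t^4}ie \\ tx_1+\frac{i}{t}x_2 & -\frac{1+t^4}{4t^2}ie & \frac{-3t^4+5}{16t}x_1+\frac{5t^4-3}{16t^3}ix_2 \\ 2ie & * & \frac{1+t^4}{8t^2}ie\end{array}\right)$$ with curvature $$\kappa((e,x_1,x_2),(h,y_1,y_2))=\left(\begin{array}{ccc}0&*&0 \\ 0&0&\frac{3(1-t^8)}{16t^5}(hx_2-ey_2)+\frac{3(1-t^8)}{16t^3}i(hx_1-ey_1) \\ 0&0&0\end{array}\right).$$ II. Up to equivalence, all regular normal extensions for $\mathfrak{so}(2,1)/\mathfrak{so}(1,1)$ (the case $c=-1$) to $\mathfrak{su}(2,1)$ are given by the following one-parameter class with parameter $s>-2$, where $t=\sqrt{\frac{s-\sqrt{s^2+4}}{-2}}$: $$\alpha(e,x_1,x_2)=\left(\begin{array}{ccc}\frac{1-t^4}{8t^2}ie & * & \frac{-(15t^8+34t^4+15)}{128t^4}ie \\ tx_1+\frac{i}{t}x_2 & -\frac{1-t^4}{4t^2}ie & \frac{3t^4+5}{16t}x_1+\frac{-5t^4-3}{16t^3}ix_2 \\ 2ie & * & \frac{1-t^4}{8t^2}ie\end{array}\right)$$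 with curvature $$\kappa((e,x_1,x_2),(h,y_1,y_2))=\left(\begin{array}{ccc}0&*&0 \\ 0&0&\frac{3(1-t^8)}{16t^5}(hx_2-ey_2)+\frac{3(1-t^8)}{16t^3}i(hx_1-ey_1) \\ 0&0&0\end{array}\right).$$ Here entries $*$ are determined by the structure of $\mathfrak{su}(2,1)$.
   Context: For $c=\pm1$, $(e,x_1,x_2)$ denotes the element $\left(\begin{array}{ccc}0&e&-x_1 \\ -ce&0&-cx_2 \\ x_1&x_2&0\end{array}\right)$ of $\mathfrak g=\mathfrak{so}(2+c,1-c)$; $\mathfrak h$ is the line $x_1=x_2=0$ and $\mathfrak m$ is the plane $e=0$. $G/H$ is a symmetric space with these Lie algebras, $h\in H$ is the element acting as $-\mathrm{id}$ on $\mathfrak m$ (and trivially on $\mathfrak h$), and $K\cong\mathbb Z_2$ is the subgroup generated by the symmetry $h$. In matrix entries $i=\sqrt{-1}$. A Cartan geometry of type $(L,P)$ is a $P$-principal bundle with an $\mathfrak l$-valued 1-form $\omega$ which is $P$-equivariant, reproduces the generators of fundamental vector fields and is an isomorphism on each tangent space. Here $\mathfrak l=\mathfrak{su}(2,1)$ is realized with respect to the hermitian form $x_0\bar y_2+x_2\bar y_0+x_1\bar y_1$ (so $A_{12}=-\overline{A_{23}}$ and $A_{32}=-\overline{A_{21}}$), with contact grading in which the $(i,j)$ entry has degree $j-i$; $\mathfrak p=\mathfrak l_0+\mathfrak l_1+\mathfrak l_2$, and $P$ is the corresponding parabolic subgroup of a group $L$ with Lie algebra $\mathfrak l$. Extension: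 a homomorphism $\iota:K\to P$ and a linear map $\alpha:\mathfrak g\to\mathfrak l$ with $\alpha\circ\mathrm{Ad}(k)=\mathrm{Ad}(\iota(k))\circ\alpha$ for $k\in K$ and inducing an isomorphism $\mathfrak g/\mathfrak k\to\mathfrak l/\mathfrak p$ (here $\mathfrak k=0$). It gives the Cartan geometry $(G\times_\iota P\to G/K,\omega_\alpha)$ of type $(L,P)$, $\omega_\alpha$ extending $\alpha\circ\omega_G$ ($\omega_G$ the Maurer–Cartan form), with curvature $\kappa(X,Y)=[\alpha(X),\alpha(Y)]-\alpha([X,Y])$ for $X,Y\in\mathfrak g$. Throughout $\iota$ is fixed, $\iota(h)=\mathrm{diag}(-1,1,-1)$. Regular: $\kappa$, viewed on $\mathfrak l/\mathfrak p$, satisfies $\kappa(\mathfrak l_i,\mathfrak l_j)\subset\bigoplus_{l\ge i+j+1}\mathfrak l_l$ for $i,j<0$. Normal: the standard (Kostant codifferential) normalization $\sum_k\kappa([Z_k,X],X_k)=2\sum_k[Z_k,\kappa(X,X_k)]$ for all $X\in\mathfrak l/\mathfrak p$, with $X_k$ a basis of $\mathfrak l/\mathfrak p$ and $Z_k$ the dual basis of $\mathfrak p_+=\mathfrak l_1+\mathfrak l_2$. Two extensions $\alpha,\alpha'$ are equivalent if there is a principal bundle morphism $\Phi$ of $G\times_\iota P$ with $\Phi^*\omega_{\alpha}=\omega_{\alpha'}$. A general regular extension has $(2,1)$ entry $b_1x_1+b_2x_2+(b_3x_1+b_4x_2)i$ with real $b_j$, $b_1b_4-b_2b_3\neq0$,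 and $(3,1)$ entry $2(b_1b_4-b_2b_3)ei$; after an equivalence one may assume $b_1b_4-b_2b_3>0$, and the parameter of its class is $s=\frac{cb_1^2+b_2^2+cb_3^2+b_4^2}{b_1b_4-b_2b_3}$, with $t=\sqrt{\frac{s+c\sqrt{s^2-4c}}{2c}}$.
   Formalization: In part II the parameter s ranges over all real numbers instead of s > -2: for t = 2 the displayed α is a regular normal extension with s = -15/4 that is not equivalent to any member with s > -2, so the printed range misses classes. *)

theory Defs
  imports "HOL-Analysis.Analysis"
begin

type_synonym rmat = "real^3^3"
type_synonym cmat = "complex^3^3"

section \<open>The symmetric pairs\<close>

text \<open>\<open>elt c e x1 x2\<close> is the element written \<open>(e, x1, x2)\<close>. It is used for \<open>c = 1\<close>
  and \<open>c = -1\<close>. The group \<open>G\<close> is taken to be the matrix group \<open>SO(2 + c, 1 - c)\<close> of the form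
  \<open>diag(1, c, 1)\<close>, which is the one whose Lie algebra consists of the matrices \<open>elt c e x1 x2\<close>;
  \<open>hsym\<close> acts as \<open>-id\<close> on \<open>e = 0\<close> and trivially on \<open>x1 = x2 = 0\<close>.\<close>

definition elt :: "real \<Rightarrow> real \<Rightarrow> real \<Rightarrow> real \<Rightarrow> rmat" where
  "elt c e x1 x2 = vector [vector [0, e, - x1], vector [- c * e, 0, - c * x2], vector [x1, x2, 0]]"

definition liealg :: "real \<Rightarrow> rmat set" where
  "liealg c = {elt c e x1 x2 | e x1 x2. True}"

definition form :: "real \<Rightarrow> rmat" where
  "form c = vector [vector [1, 0, 0], vector [0, c, 0], vector [0, 0, 1]]"

definition Ggrp :: "real \<Rightarrow> rmat set" where
  "Ggrp c = {g. det g = 1 \<and> transpose g ** form c ** g = form c}"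

definition hsym :: rmat where
  "hsym = vector [vector [- 1, 0, 0], vector [0, - 1, 0], vector [0, 0, 1]]"

definition Kgrp :: "rmat set" where
  "Kgrp = {mat 1, hsym}"

definition lb :: "'a::ring_1^'n^'n \<Rightarrow> 'a^'n^'n \<Rightarrow> 'a^'n^'n" where
  "lb A B = A ** B - B ** A"

definition Ad :: "'a::ring_1^'n^'n \<Rightarrow> 'a^'n^'n \<Rightarrow> 'a^'n^'n" where
  "Ad g X = g ** X ** matrix_inv g"


section \<open>The Lie algebra su(2,1) with its contact grading, and the parabolic subgroup\<close>

text \<open>The coordinates \<open>x0, x1, x2\<close> of the hermitian form are the components \<open>1, 2, 3\<close>.\<close>

definition herm :: "complex^3 \<Rightarrow> complex^3 \<Rightarrow> complex" where
  "herm x y = x$1 * cnj (y$3) + x$3 * cnj (y$1) + x$2 * cnj (y$2)"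

definition su21 :: "cmat set" where
  "su21 = {A. trace A = 0 \<and> (\<forall>x y. herm (A *v x) y + herm x (A *v y) = 0)}"

definition SU21 :: "cmat set" where
  "SU21 = {A. det A = 1 \<and> (\<forall>x y. herm (A *v x) (A *v y) = herm x y)}"

text \<open>Arithmetic in the index type \<open>3\<close> is modulo 3, so positions are first sent to \<open>int\<close>.\<close>

definition pos :: "3 \<Rightarrow> int" where
  "pos i = (if i = 1 then 1 else if i = 2 then 2 else 3)"

definition grade :: "int \<Rightarrow> cmat set" where
  "grade k = {A \<in> su21. \<forall>i j. A$i$j \<noteq> 0 \<longrightarrow> pos j - pos i = k}"

definition filt :: "int \<Rightarrow> cmat set" where
  "filt k = {A \<in> su21. \<forall>i j. A$i$j \<noteq> 0 \<longrightarrow> k \<le> pos j - pos i}"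

abbreviation parab :: "cmat set" where
  "parab \<equiv> filt 0"

abbreviation parab_plus :: "cmat set" where
  "parab_plus \<equiv> filt 1"

definition Pgrp :: "cmat set" where
  "Pgrp = {A \<in> SU21. \<forall>i j. A$i$j \<noteq> 0 \<longrightarrow> 0 \<le> pos j - pos i}"


section \<open>Extensions, curvature, regularity and normality\<close>

definition iota :: "rmat \<Rightarrow> cmat" where
  "iota k = (if k = hsym
     then vector [vector [- 1, 0, 0], vector [0, 1, 0], vector [0, 0, - 1]] else mat 1)"

text \<open>Only the values of \<open>\<alpha>\<close> on \<open>liealg c\<close> matter. As the Lie algebra of \<open>K\<close> is zero, the last
  condition says that \<open>\<alpha>\<close> induces a bijection from \<open>liealg c\<close> onto \<open>su21 / parab\<close>.\<close>

definition extension :: "real \<Rightarrow> (rmat \<Rightarrow> cmat) \<Rightarrow> bool" where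
  "extension c \<alpha> \<longleftrightarrow>
     \<alpha> ` liealg c \<subseteq> su21 \<and>
     (\<forall>X\<in>liealg c. \<forall>Y\<in>liealg c. \<forall>a b. \<alpha> (a *\<^sub>R X + b *\<^sub>R Y) = a *\<^sub>R \<alpha> X + b *\<^sub>R \<alpha> Y) \<and>
     (\<forall>k\<in>Kgrp. \<forall>X\<in>liealg c. \<alpha> (Ad k X) = Ad (iota k) (\<alpha> X)) \<and>
     (\<forall>U\<in>su21. \<exists>!X. X \<in> liealg c \<and> \<alpha> X - U \<in> parab)"

definition kappa :: "(rmat \<Rightarrow> cmat) \<Rightarrow> rmat \<Rightarrow> rmat \<Rightarrow> cmat" where
  "kappa \<alpha> X Y = lb (\<alpha> X) (\<alpha> Y) - \<alpha> (lb X Y)"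

definition corep :: "real \<Rightarrow> (rmat \<Rightarrow> cmat) \<Rightarrow> cmat \<Rightarrow> rmat" where
  "corep c \<alpha> U = (THE X. X \<in> liealg c \<and> \<alpha> X - U \<in> parab)"

text \<open>The curvature as a map on \<open>su21 / parab\<close>, evaluated at the classes of \<open>U\<close> and \<open>V\<close>.\<close>

definition kappa_quot ::
  "real \<Rightarrow> (rmat \<Rightarrow> cmat) \<Rightarrow> cmat \<Rightarrow> cmat \<Rightarrow> cmat" where
  "kappa_quot c \<alpha> U V = kappa \<alpha> (corep c \<alpha> U) (corep c \<alpha> V)"

definition regular :: "real \<Rightarrow> (rmat \<Rightarrow> cmat) \<Rightarrow> bool" where
  "regular c \<alpha> \<longleftrightarrow>
     (\<forall>i<0. \<forall>j<0. \<forall>U\<in>grade i. \<forall>V\<in>grade j. kappa_quot c \<alpha> U V \<in> filt (i + j + 1))"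

text \<open>Classes of \<open>X k\<close> in \<open>su21 / parab\<close> (of dimension 3) and their dual basis \<open>Z k\<close> of
  \<open>parab_plus\<close>. The pairing is the trace form, a multiple of the Killing form; rescaling it
  rescales all \<open>Z k\<close> and so does not affect normality.\<close>

definition dual_bases :: "(3 \<Rightarrow> cmat) \<Rightarrow> (3 \<Rightarrow> cmat) \<Rightarrow> bool" where
  "dual_bases X Z \<longleftrightarrow> (\<forall>k. X k \<in> su21) \<and> (\<forall>k. Z k \<in> parab_plus) \<and>
     (\<forall>j k. trace (Z j ** X k) = (if j = k then 1 else 0))"

definition normal_ext :: "real \<Rightarrow> (rmat \<Rightarrow> cmat) \<Rightarrow> bool" where
  "normal_ext c \<alpha> \<longleftrightarrow>
     (\<forall>X Z. dual_bases X Z \<longrightarrow>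
       (\<forall>U\<in>su21. (\<Sum>k\<in>UNIV. kappa_quot c \<alpha> (lb (Z k) U) (X k))
                 = 2 *\<^sub>R (\<Sum>k\<in>UNIV. lb (Z k) (kappa_quot c \<alpha> U (X k)))))"

definition regular_normal_extension :: "real \<Rightarrow> (rmat \<Rightarrow> cmat) \<Rightarrow> bool" where
  "regular_normal_extension c \<alpha> \<longleftrightarrow> extension c \<alpha> \<and> regular c \<alpha> \<and> normal_ext c \<alpha>"


section \<open>The bundle G \<open>\<times>\<^sub>\<iota>\<close> P and equivalence of extensions\<close>

text \<open>A point of the bundle is an orbit of the free action of \<open>K\<close> on \<open>G \<times> P\<close> that identifies
  \<open>(g k, p)\<close> with \<open>(g, \<iota>(k) p)\<close>.\<close>

definition proj :: "rmat \<times> cmat \<Rightarrow> (rmat \<times> cmat) set" where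
  "proj = (\<lambda>(g, p). {(g ** k, matrix_inv (iota k) ** p) | k. k \<in> Kgrp})"

definition bundle_space :: "real \<Rightarrow> (rmat \<times> cmat) set set" where
  "bundle_space c = proj ` (Ggrp c \<times> Pgrp)"

definition ract ::
  "(rmat \<times> cmat) set \<Rightarrow> cmat \<Rightarrow> (rmat \<times> cmat) set" where
  "ract u q = (\<lambda>(g, p). (g, p ** q)) ` u"

text \<open>The pullback of \<open>\<omega>\<^sub>\<alpha>\<close> along \<open>proj\<close>: the \<open>P\<close>-equivariant form on \<open>G \<times> P\<close> that restricts to
  \<open>\<alpha> \<circ> \<omega>\<^sub>G\<close> on \<open>G \<times> {1}\<close> and reproduces the generators of the \<open>P\<close>-action, evaluated at the
  tangent vector \<open>(u, v)\<close> at \<open>(g, p)\<close>.\<close>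

definition omega :: "(rmat \<Rightarrow> cmat) \<Rightarrow> rmat \<times> cmat \<Rightarrow>
    rmat \<times> cmat \<Rightarrow> cmat" where
  "omega \<alpha> = (\<lambda>(g, p) (u, v). Ad (matrix_inv p) (\<alpha> (matrix_inv g ** u)) + matrix_inv p ** v)"

definition tangent :: "real \<Rightarrow> rmat \<times> cmat \<Rightarrow> (rmat \<times> cmat) set" where
  "tangent c = (\<lambda>(g, p). {(g ** X, p ** Y) | X Y. X \<in> liealg c \<and> Y \<in> parab})"

text \<open>\<open>Ck k U f\<close>: \<open>f\<close> is \<open>k\<close> times continuously differentiable on the open set \<open>U\<close>.\<close>

primrec Ck :: "nat \<Rightarrow> 'a::euclidean_space set \<Rightarrow> ('a \<Rightarrow> 'b::euclidean_space) \<Rightarrow> bool" where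
  "Ck 0 U f \<longleftrightarrow> continuous_on U f"
| "Ck (Suc k) U f \<longleftrightarrow>
     (\<exists>f'. (\<forall>x\<in>U. (f has_derivative f' x) (at x)) \<and> (\<forall>v. Ck k U (\<lambda>x. f' x v)))"

definition smooth_on :: "'a::euclidean_space set \<Rightarrow> ('a \<Rightarrow> 'b::euclidean_space) \<Rightarrow> bool" where
  "smooth_on U f \<longleftrightarrow> open U \<and> (\<forall>k. Ck k U f)"

text \<open>As \<open>proj\<close> is a covering of \<open>G \<times>\<^sub>\<iota> P\<close> by the submanifold \<open>G \<times> P\<close> of a vector space, a map of
  \<open>G \<times>\<^sub>\<iota> P\<close> is smooth iff near every point of \<open>G \<times> P\<close> it is covered by the restriction of a
  smooth map of the vector space.\<close>

definition local_lift :: "real \<Rightarrow>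
    ((rmat \<times> cmat) set \<Rightarrow> (rmat \<times> cmat) set) \<Rightarrow>
    (rmat \<times> cmat) set \<Rightarrow> (rmat \<times> cmat \<Rightarrow> rmat \<times> cmat) \<Rightarrow> bool" where
  "local_lift c \<Phi> U F \<longleftrightarrow> smooth_on U F \<and>
     (\<forall>x \<in> U \<inter> (Ggrp c \<times> Pgrp). F x \<in> Ggrp c \<times> Pgrp \<and> proj (F x) = \<Phi> (proj x))"

definition bundle_morphism :: "real \<Rightarrow>
    ((rmat \<times> cmat) set \<Rightarrow> (rmat \<times> cmat) set) \<Rightarrow> bool" where
  "bundle_morphism c \<Phi> \<longleftrightarrow>
     \<Phi> ` bundle_space c \<subseteq> bundle_space c \<and>
     (\<forall>u\<in>bundle_space c. \<forall>q\<in>Pgrp. \<Phi> (ract u q) = ract (\<Phi> u) q) \<and>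
     (\<forall>x \<in> Ggrp c \<times> Pgrp. \<exists>U F. x \<in> U \<and> local_lift c \<Phi> U F)"

text \<open>\<open>\<Phi>\<^sup>* \<omega>\<^sub>\<alpha> = \<omega>\<^sub>\<alpha>\<^sub>'\<close>, computed at each point through a local lift of \<open>\<Phi>\<close>; \<open>omega \<alpha>\<close> is invariant
  under \<open>K\<close>, so the choice of the lift does not matter.\<close>

definition pullback_eq :: "real \<Rightarrow> ((rmat \<times> cmat) set \<Rightarrow> (rmat \<times> cmat) set) \<Rightarrow>
    (rmat \<Rightarrow> cmat) \<Rightarrow> (rmat \<Rightarrow> cmat) \<Rightarrow> bool" where
  "pullback_eq c \<Phi> \<alpha> \<alpha>' \<longleftrightarrow>
     (\<forall>x \<in> Ggrp c \<times> Pgrp. \<exists>U F. x \<in> U \<and> local_lift c \<Phi> U F \<and>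
        (\<forall>w \<in> tangent c x. omega \<alpha> (F x) (frechet_derivative F (at x) w) = omega \<alpha>' x w))"

definition equivalent ::
  "real \<Rightarrow> (rmat \<Rightarrow> cmat) \<Rightarrow> (rmat \<Rightarrow> cmat) \<Rightarrow> bool" where
  "equivalent c \<alpha> \<alpha>' \<longleftrightarrow> (\<exists>\<Phi>. bundle_morphism c \<Phi> \<and> pullback_eq c \<Phi> \<alpha> \<alpha>')"


section \<open>The parameter and the normal forms\<close>

text \<open>With \<open>b1 x1 + b2 x2 + (b3 x1 + b4 x2) i\<close> the (2,1) entry of \<open>\<alpha>\<close>:
  \<open>bdet c \<alpha> = b1 b4 - b2 b3\<close>, and \<open>param c \<alpha>\<close> is the parameter (meant for \<open>bdet c \<alpha> > 0\<close>).\<close>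

definition bdet :: "real \<Rightarrow> (rmat \<Rightarrow> cmat) \<Rightarrow> real" where
  "bdet c \<alpha> = (let u = \<alpha> (elt c 0 1 0) $ 2 $ 1; v = \<alpha> (elt c 0 0 1) $ 2 $ 1
               in Re u * Im v - Re v * Im u)"

definition param :: "real \<Rightarrow> (rmat \<Rightarrow> cmat) \<Rightarrow> real" where
  "param c \<alpha> = (let u = \<alpha> (elt c 0 1 0) $ 2 $ 1; v = \<alpha> (elt c 0 0 1) $ 2 $ 1
                in (c * (Re u)\<^sup>2 + (Re v)\<^sup>2 + c * (Im u)\<^sup>2 + (Im v)\<^sup>2) / bdet c \<alpha>)"

text \<open>An element of \<open>su21\<close>, determined by its entries other than (1,2) and (3,2).\<close>

definition su_mat :: "complex \<Rightarrow> complex \<Rightarrow> complex \<Rightarrow> complex \<Rightarrow> complex \<Rightarrow> complex \<Rightarrow> complex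
    \<Rightarrow> cmat" where
  "su_mat a11 a13 a21 a22 a23 a31 a33 = vector
     [vector [a11, - cnj a23, a13],
      vector [a21, a22, a23],
      vector [a31, - cnj a21, a33]]"

definition on_coords :: "(real \<Rightarrow> real \<Rightarrow> real \<Rightarrow> cmat) \<Rightarrow> rmat \<Rightarrow> cmat" where
  "on_coords f X = f (X$1$2) (X$3$1) (X$3$2)"

definition alpha_so3 :: "real \<Rightarrow> rmat \<Rightarrow> cmat" where
  "alpha_so3 t = on_coords (\<lambda>e x1 x2. su_mat
     (of_real ((1 + t^4) / (8 * t^2) * e) * \<i>)
     (of_real (- (15 * t^8 - 34 * t^4 + 15) / (128 * t^4) * e) * \<i>)
     (of_real (t * x1) + of_real (1 / t * x2) * \<i>)
     (of_real (- (1 + t^4) / (4 * t^2) * e) * \<i>)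
     (of_real ((- 3 * t^4 + 5) / (16 * t) * x1) + of_real ((5 * t^4 - 3) / (16 * t^3) * x2) * \<i>)
     (of_real (2 * e) * \<i>)
     (of_real ((1 + t^4) / (8 * t^2) * e) * \<i>))"

definition alpha_so21 :: "real \<Rightarrow> rmat \<Rightarrow> cmat" where
  "alpha_so21 t = on_coords (\<lambda>e x1 x2. su_mat
     (of_real ((1 - t^4) / (8 * t^2) * e) * \<i>)
     (of_real (- (15 * t^8 + 34 * t^4 + 15) / (128 * t^4) * e) * \<i>)
     (of_real (t * x1) + of_real (1 / t * x2) * \<i>)
     (of_real (- (1 - t^4) / (4 * t^2) * e) * \<i>)
     (of_real ((3 * t^4 + 5) / (16 * t) * x1) + of_real ((- 5 * t^4 - 3) / (16 * t^3) * x2) * \<i>)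
     (of_real (2 * e) * \<i>)
     (of_real ((1 - t^4) / (8 * t^2) * e) * \<i>))"

text \<open>The value of the curvature on \<open>(e, x1, x2)\<close> and \<open>(h, y1, y2)\<close>, for both pairs.\<close>

definition kappa_nf :: "real \<Rightarrow> real \<Rightarrow> real \<Rightarrow> real \<Rightarrow> real \<Rightarrow> real \<Rightarrow> real \<Rightarrow> cmat" where
  "kappa_nf t e x1 x2 h y1 y2 = su_mat 0 0 0 0
     (of_real (3 * (1 - t^8) / (16 * t^5) * (h * x2 - e * y2))
       + of_real (3 * (1 - t^8) / (16 * t^3) * (h * x1 - e * y1)) * \<i>)
     0 0"

text \<open>\<open>t_so3\<close> maps \<open>s \<ge> 2\<close> onto \<open>t \<ge> 1\<close> with inverse \<open>s = t^2 + 1 / t^2\<close>; \<open>t_so21\<close> maps all of \<open>\<real>\<close>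
  onto \<open>t > 0\<close> with inverse \<open>s = 1 / t^2 - t^2\<close>. For \<open>c = -1\<close> every real \<open>s\<close> is the parameter of a
  regular normal extension, and none of these classes can be omitted.\<close>

definition t_so3 :: "real \<Rightarrow> real" where
  "t_so3 s = sqrt ((s + sqrt (s^2 - 4)) / 2)"

definition t_so21 :: "real \<Rightarrow> real" where
  "t_so21 s = sqrt ((s - sqrt (s^2 + 4)) / (- 2))"

end

theory Submission
  imports Defs
begin

text \<open>
  Both parts are proved together, for a real \<open>c\<close> with \<open>c\<^sup>2 = 1\<close>; the two displayed families are
  one family \<open>alpha_nf c t\<close>.

  An extension commutes with the symmetry \<open>h\<close>, so it maps \<open>\<hh>\<close> into the part of \<open>su21\<close> of even
  degree and \<open>\<mm>\<close> into the part of odd degree (\<open>extension_coords\<close>). Hence it is a list of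
  constants: \<open>z1, z2\<close> for the entry (2,1), \<open>w1, w2\<close> for (2,3), and the values \<open>a, i p, i u\<close> of the
  entries (1,1), (3,1), (1,3) on \<open>(1, 0, 0)\<close>. That \<open>\<alpha>\<close> induces an isomorphism makes \<open>z1, z2\<close> linearly
  independent over \<open>\<real>\<close>, and regularity says exactly that \<open>p = 2 D\<close>, where \<open>D\<close> is the determinant of
  \<open>z1, z2\<close> (\<open>regular_coords\<close>).

  Two kinds of bundle morphisms are available: right multiplication on \<open>G\<close> by an element \<open>g\<close> that
  commutes with \<open>h\<close>, and left multiplication on \<open>P\<close> by an element \<open>q\<close> that commutes with \<open>\<iota>(h)\<close>.
  Together they replace \<open>\<alpha>\<close> by \<open>Ad(q)\<^sup>-\<^sup>1 \<circ> \<alpha> \<circ> Ad(g)\<^sup>-\<^sup>1\<close>, which is again a normal extension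
  (\<open>equivalent_transform\<close>, \<open>extension_transform\<close>, \<open>normal_transform\<close>). If \<open>D < 0\<close>, the element
  \<open>diag(-1, 1, -1)\<close> of \<open>G\<close> changes its sign. If \<open>D > 0\<close>, the positive definite quadratic form
  \<open>|x1 z1 + x2 z2|\<^sup>2\<close> and the form \<open>c x1\<^sup>2 + x2\<^sup>2\<close> preserved by \<open>g\<close> are diagonalized simultaneously
  (\<open>diagonalize_pair\<close>); the diagonal entries have product \<open>D\<^sup>2\<close>, so only their ratio, written
  \<open>t\<^sup>4\<close>, survives a rescaling by the degree 0 part of \<open>q\<close>, and the trace of the first form with respect
  to the second, divided by \<open>D\<close>, gives \<open>s = c t\<^sup>2 + 1 / t\<^sup>2\<close>. The degree 2
  part of \<open>q\<close> removes the real part of the entry (1,1). After this the (2,1) entry is \<open>t x1 + i x2 / t\<close> and the (3,1) entry is \<open>2 i e\<close>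
  (\<open>gauge_normalizes\<close>).

  The constants left are the imaginary part of \<open>a\<close>, the complex numbers \<open>w1, w2\<close> and \<open>u\<close>. Evaluated
  on one pair of dual bases, the normality condition becomes a system of real equations for them. The
  components of degree 0 and 1 are linear and determine all constants but \<open>u\<close>; the component of
  degree 2 then determines \<open>u\<close> (\<open>normal_unique\<close>). So at most \<open>alpha_nf c t\<close> is possible.

  Conversely the curvature of \<open>alpha_nf c t\<close> has values in degree 1 only, so it is regular, and for
  curvatures of this form normality reduces to identities between the coordinates of dual bases which
  say that a right inverse matrix is a left inverse (\<open>normal_alpha_nf\<close>).
\<close>

section \<open>Coordinates on su(2,1) and on the Lie algebra of G\<close>

text \<open>Coordinates on \<open>su21\<close> as a real vector space. The degrees are \<open>-2\<close> for \<open>p\<close>, \<open>-1\<close> for \<open>z\<close>, \<open>0\<close> for \<open>a\<close>, \<open>1\<close> for \<open>w\<close>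
  and \<open>2\<close> for \<open>u\<close>; thus \<open>p\<close> and \<open>z\<close> are coordinates on the quotient by \<open>parab\<close>. Working with them
  turns matrix identities in \<open>su21\<close> into identities between five scalars.\<close>

definition su_el :: "complex \<Rightarrow> complex \<Rightarrow> complex \<Rightarrow> real \<Rightarrow> real \<Rightarrow> cmat" where
  "su_el a z w p u =
     su_mat a (of_real u * \<i>) z (- 2 * of_real (Im a) * \<i>) w (of_real p * \<i>) (- cnj a)"

lemma su_el_entries [simp]:
  "su_el a z w p u $ 1 $ 1 = a" "su_el a z w p u $ 1 $ 2 = - cnj w"
  "su_el a z w p u $ 1 $ 3 = of_real u * \<i>"
  "su_el a z w p u $ 2 $ 1 = z" "su_el a z w p u $ 2 $ 2 = - 2 * of_real (Im a) * \<i>"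
  "su_el a z w p u $ 2 $ 3 = w"
  "su_el a z w p u $ 3 $ 1 = of_real p * \<i>" "su_el a z w p u $ 3 $ 2 = - cnj z"
  "su_el a z w p u $ 3 $ 3 = - cnj a"
  by (simp_all add: su_el_def su_mat_def)

lemma mat3_eq_iff: "(A :: 'a^3^3) = B \<longleftrightarrow>
    A$1$1 = B$1$1 \<and> A$1$2 = B$1$2 \<and> A$1$3 = B$1$3 \<and>
    A$2$1 = B$2$1 \<and> A$2$2 = B$2$2 \<and> A$2$3 = B$2$3 \<and>
    A$3$1 = B$3$1 \<and> A$3$2 = B$3$2 \<and> A$3$3 = B$3$3"
  by (auto simp: vec_eq_iff forall_3)

lemma mult3_entry: "((A :: 'a::semiring_1^3^3) ** B) $ i $ j
    = A$i$1 * B$1$j + A$i$2 * B$2$j + A$i$3 * B$3$j"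
  by (simp add: matrix_matrix_mult_def sum_3)

lemma su_el_eq_iff [simp]: "su_el a z w p u = su_el a' z' w' p' u' \<longleftrightarrow>
    a = a' \<and> z = z' \<and> w = w' \<and> p = p' \<and> u = u'"
  by (auto simp: mat3_eq_iff)

text \<open>Testing skewness on pairs of basis vectors gives the linear relations between the entries.\<close>

lemma su21_iff: "A \<in> su21 \<longleftrightarrow> (\<exists>a z w p u. A = su_el a z w p u)"
proof
  assume A: "A \<in> su21"
  then have H: "herm (A *v axis i 1) (axis j 1) + herm (axis i 1) (A *v axis j 1) = 0" for i j
    by (simp add: su21_def)
  note ent = herm_def matrix_vector_mult_def sum_3 axis_def
  have "A$3$1 + cnj (A$3$1) = 0" using H[of 1 1] by (simp add: ent)
  moreover have "A$1$3 + cnj (A$1$3) = 0" using H[of 3 3] by (simp add: ent)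
  moreover have "A$2$1 + cnj (A$3$2) = 0" using H[of 1 2] by (simp add: ent)
  moreover have "A$2$3 + cnj (A$1$2) = 0" using H[of 3 2] by (simp add: ent)
  moreover have "A$3$3 + cnj (A$1$1) = 0" using H[of 3 1] by (simp add: ent)
  moreover have "A$1$1 + A$2$2 + A$3$3 = 0" using A by (simp add: su21_def trace_def sum_3)
  ultimately have
    "A = su_el (A$1$1) (A$2$1) (A$2$3) (Im (A$3$1)) (Im (A$1$3))"
    by (simp add: mat3_eq_iff complex_eq_iff)
  then show "\<exists>a z w p u. A = su_el a z w p u" by blast
next
  assume "\<exists>a z w p u. A = su_el a z w p u"
  then obtain a z w p u where A: "A = su_el a z w p u" by blast
  have "trace A = 0" by (simp add: A trace_def sum_3 complex_eq_iff)
  moreover have "herm (A *v x) y + herm x (A *v y) = 0" for x y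
    by (simp add: A herm_def matrix_vector_mult_def sum_3 complex_eq_iff algebra_simps)
  ultimately show "A \<in> su21" by (simp add: su21_def)
qed

lemma su_el_in_su21 [simp]: "su_el a z w p u \<in> su21"
  by (auto simp: su21_iff)

lemma pos_simps [simp]: "pos 1 = 1" "pos 2 = 2" "pos 3 = 3"
  by (simp_all add: pos_def)

lemma su_el_in_parab [simp]: "su_el a z w p u \<in> parab \<longleftrightarrow> z = 0 \<and> p = 0"
  by (auto simp: filt_def forall_3)

lemma su_el_in_parab_plus [simp]: "su_el a z w p u \<in> parab_plus \<longleftrightarrow> a = 0 \<and> z = 0 \<and> p = 0"
  by (auto simp: filt_def forall_3)

lemma lb_su_el: "lb (su_el a z w p u) (su_el a' z' w' p' u') = su_el
    (cnj w' * z - cnj w * z' - of_real (u * p' - u' * p))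
    (z * (a' + 2 * of_real (Im a') * \<i>) - z' * (a + 2 * of_real (Im a) * \<i>)
       + (w * of_real p' - w' * of_real p) * \<i>)
    ((z * of_real u' - z' * of_real u) * \<i> - w * (cnj a' - 2 * of_real (Im a') * \<i>)
       + w' * (cnj a - 2 * of_real (Im a) * \<i>))
    (2 * p * Re a' - 2 * p' * Re a + 2 * Im (z * cnj z'))
    (2 * u' * Re a - 2 * u * Re a' + 2 * Im (w * cnj w'))"
  by (simp add: lb_def mat3_eq_iff mult3_entry) (simp add: complex_eq_iff algebra_simps)

lemma su_el_add: "su_el a z w p u + su_el a' z' w' p' u'
    = su_el (a + a') (z + z') (w + w') (p + p') (u + u')"
  by (simp add: mat3_eq_iff algebra_simps)

lemma su_el_diff: "su_el a z w p u - su_el a' z' w' p' u'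
    = su_el (a - a') (z - z') (w - w') (p - p') (u - u')"
  by (simp add: mat3_eq_iff algebra_simps)

lemma su_el_scaleR: "r *\<^sub>R su_el a z w p u
    = su_el (r *\<^sub>R a) (r *\<^sub>R z) (r *\<^sub>R w) (r * p) (r * u)"
  by (simp add: mat3_eq_iff) (simp add: complex_eq_iff)

lemma elt_entries [simp]:
  "elt c e x1 x2 $ 1 $ 1 = 0" "elt c e x1 x2 $ 1 $ 2 = e" "elt c e x1 x2 $ 1 $ 3 = - x1"
  "elt c e x1 x2 $ 2 $ 1 = - c * e" "elt c e x1 x2 $ 2 $ 2 = 0" "elt c e x1 x2 $ 2 $ 3 = - c * x2"
  "elt c e x1 x2 $ 3 $ 1 = x1" "elt c e x1 x2 $ 3 $ 2 = x2" "elt c e x1 x2 $ 3 $ 3 = 0"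
  by (simp_all add: elt_def)

lemma elt_in_liealg [simp]: "elt c e x1 x2 \<in> liealg c"
  by (auto simp: liealg_def)

lemma liealgE:
  assumes "X \<in> liealg c" obtains e x1 x2 where "X = elt c e x1 x2"
  using assms by (auto simp: liealg_def)

lemma elt_eq_iff [simp]: "elt c e x1 x2 = elt c h y1 y2 \<longleftrightarrow> e = h \<and> x1 = y1 \<and> x2 = y2"
  by (auto simp: mat3_eq_iff)

lemma elt_add: "elt c e x1 x2 + elt c h y1 y2 = elt c (e + h) (x1 + y1) (x2 + y2)"
  by (simp add: mat3_eq_iff algebra_simps)

lemma elt_scaleR: "r *\<^sub>R elt c e x1 x2 = elt c (r * e) (r * x1) (r * x2)"
  by (simp add: mat3_eq_iff)

lemma lb_elt:
  assumes "c^2 = 1"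
  shows "lb (elt c e x1 x2) (elt c h y1 y2)
    = elt c (x2 * y1 - x1 * y2) (c * (e * y2 - h * x2)) (h * x1 - e * y1)"
  using assms by (simp add: lb_def mat3_eq_iff mult3_entry algebra_simps power2_eq_square)

section \<open>The normal forms are regular normal extensions\<close>

definition alpha_nf :: "real \<Rightarrow> real \<Rightarrow> rmat \<Rightarrow> cmat" where
  "alpha_nf c t = on_coords (\<lambda>e x1 x2. su_el
     (of_real ((1 + c * t^4) / (8 * t^2) * e) * \<i>)
     (Complex (t * x1) (x2 / t))
     (Complex ((5 - 3 * c * t^4) / (16 * t) * x1) ((5 * c * t^4 - 3) / (16 * t^3) * x2))
     (2 * e)
     (- (15 * t^8 - 34 * c * t^4 + 15) / (128 * t^4) * e))"

lemma alpha_so3_eq: "alpha_so3 t = alpha_nf 1 t"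
  unfolding alpha_so3_def alpha_nf_def on_coords_def
  by (intro ext, cases "t = 0") (simp_all add: mat3_eq_iff su_mat_def complex_eq_iff field_simps)

lemma alpha_so21_eq: "alpha_so21 t = alpha_nf (- 1) t"
  unfolding alpha_so21_def alpha_nf_def on_coords_def
  by (intro ext, cases "t = 0") (simp_all add: mat3_eq_iff su_mat_def complex_eq_iff field_simps)

lemma alpha_nf_elt: "alpha_nf c t (elt c' e x1 x2) = su_el
     (of_real ((1 + c * t^4) / (8 * t^2) * e) * \<i>)
     (Complex (t * x1) (x2 / t))
     (Complex ((5 - 3 * c * t^4) / (16 * t) * x1) ((5 * c * t^4 - 3) / (16 * t^3) * x2))
     (2 * e)
     (- (15 * t^8 - 34 * c * t^4 + 15) / (128 * t^4) * e)"
  by (simp add: alpha_nf_def on_coords_def)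

lemma kappa_nf_eq: "kappa_nf t e x1 x2 h y1 y2 = su_el 0 0
    (Complex (3 * (1 - t^8) / (16 * t^5) * (h * x2 - e * y2))
       (3 * (1 - t^8) / (16 * t^3) * (h * x1 - e * y1))) 0 0"
  by (simp add: kappa_nf_def mat3_eq_iff su_mat_def complex_eq_iff)

lemma kappa_alpha_nf:
  assumes c: "c^2 = 1" and t: "t \<noteq> 0"
  shows "kappa (alpha_nf c t) (elt c e x1 x2) (elt c h y1 y2) = kappa_nf t e x1 x2 h y1 y2"
proof -
  have cc: "c * (c * r) = r" for r using c by (simp add: power2_eq_square flip: mult.assoc)
  show ?thesis
    using t unfolding kappa_def lb_elt[OF c] alpha_nf_elt lb_su_el su_el_diff kappa_nf_eq su_el_eq_iff
    by (intro conjI; simp add: complex_eq_iff; simp add: field_simps cc power_numeral_reduce)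
qed
lemma matrix_inv_unique:
  assumes "A ** B = mat 1" and "B ** A = mat 1"
  shows "matrix_inv A = B"
proof -
  have inv: "A ** matrix_inv A = mat 1 \<and> matrix_inv A ** A = mat 1"
    unfolding matrix_inv_def by (rule someI[of _ B]) (simp add: assms)
  have "matrix_inv A = (B ** A) ** matrix_inv A" by (simp add: assms)
  also have "\<dots> = B" using inv by (simp flip: matrix_mul_assoc)
  finally show ?thesis .
qed

lemma hsym_ne_mat_1: "mat 1 \<noteq> hsym" "hsym \<noteq> mat 1"
  by (auto simp: hsym_def mat3_eq_iff mat_def)

lemma iota_simps: "iota (mat 1) = mat 1"
  "iota hsym = vector [vector [- 1, 0, 0], vector [0, 1, 0], vector [0, 0, - 1]]"
  by (simp_all add: iota_def hsym_ne_mat_1)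

lemma hsym_sq: "hsym ** hsym = mat 1"
  by (simp add: hsym_def mat3_eq_iff mult3_entry mat_def)

lemma iota_hsym_sq: "iota hsym ** iota hsym = mat 1"
  by (simp add: iota_simps mat3_eq_iff mult3_entry mat_def)

lemma matrix_inv_simps: "matrix_inv (mat 1 :: 'a::semiring_1^'n^'n) = mat 1"
  "matrix_inv hsym = hsym" "matrix_inv (iota hsym) = iota hsym"
  by (simp_all add: matrix_inv_unique hsym_sq iota_hsym_sq)

lemma Ad_mat_1 [simp]: "Ad (mat 1) X = X"
  by (simp add: Ad_def matrix_inv_simps)

lemma Ad_hsym_elt: "Ad hsym (elt c e x1 x2) = elt c e (- x1) (- x2)"
  by (simp add: Ad_def matrix_inv_simps) (simp add: hsym_def mat3_eq_iff mult3_entry)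

lemma Ad_iota_hsym_su_el: "Ad (iota hsym) (su_el a z w p u) = su_el a (- z) (- w) p u"
  by (simp add: Ad_def matrix_inv_simps) (simp add: iota_simps mat3_eq_iff mult3_entry)

text \<open>This makes representatives of classes modulo \<open>parab\<close> computable: it suffices to exhibit one.\<close>

lemma corep_eqI:
  assumes "extension c \<alpha>" and "U \<in> su21" and "X \<in> liealg c" and "\<alpha> X - U \<in> parab"
  shows "corep c \<alpha> U = X"
  unfolding corep_def using assms unfolding extension_def by (intro the1_equality) auto

lemma extension_alpha_nf:
  assumes t: "t \<noteq> 0"
  shows "extension c (alpha_nf c t)"
  unfolding extension_def
proof (intro conjI ballI allI)
  show "alpha_nf c t ` liealg c \<subseteq> su21"
    by (auto elim!: liealgE simp: alpha_nf_elt)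
next
  fix X Y a b assume "X \<in> liealg c" "Y \<in> liealg c"
  then show "alpha_nf c t (a *\<^sub>R X + b *\<^sub>R Y) = a *\<^sub>R alpha_nf c t X + b *\<^sub>R alpha_nf c t Y"
    by (auto elim!: liealgE simp: alpha_nf_elt elt_scaleR elt_add su_el_scaleR su_el_add
        complex_eq_iff add_divide_distrib diff_divide_distrib algebra_simps)
next
  fix k X assume "k \<in> Kgrp" "X \<in> liealg c"
  then show "alpha_nf c t (Ad k X) = Ad (iota k) (alpha_nf c t X)"
    by (auto elim!: liealgE simp: Kgrp_def iota_simps(1) Ad_hsym_elt Ad_iota_hsym_su_el alpha_nf_elt
        complex_eq_iff)
next
  fix U assume "U \<in> su21"
  then obtain a z w p u where U: "U = su_el a z w p u" by (auto simp: su21_iff)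
  show "\<exists>!X. X \<in> liealg c \<and> alpha_nf c t X - U \<in> parab"
  proof (rule ex1I)
    show "elt c (p / 2) (Re z / t) (t * Im z) \<in> liealg c \<and>
        alpha_nf c t (elt c (p / 2) (Re z / t) (t * Im z)) - U \<in> parab"
      using t by (simp add: U alpha_nf_elt su_el_diff complex_eq_iff)
  qed (use t in \<open>auto elim!: liealgE simp: U alpha_nf_elt su_el_diff complex_eq_iff field_simps\<close>)
qed

lemma corep_alpha_nf:
  assumes "t \<noteq> 0"
  shows "corep c (alpha_nf c t) (su_el a z w p u) = elt c (p / 2) (Re z / t) (t * Im z)"
  by (rule corep_eqI[OF extension_alpha_nf])
     (use assms in \<open>simp_all add: alpha_nf_elt su_el_diff complex_eq_iff\<close>)

text \<open>Written on \<open>su21 / parab\<close>, the curvature is one constant times the conjugate of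
  \<open>p' z - p z'\<close>. The conjugation makes the right-hand side of the normality condition cancel.\<close>

lemma kappa_quot_alpha_nf:
  assumes "c^2 = 1" and t: "t \<noteq> 0"
  shows "kappa_quot c (alpha_nf c t) (su_el a z w p u) (su_el a' z' w' p' u')
    = (let C = 3 * (1 - t^8) / (32 * t^4)
       in su_el 0 0 (of_real C * \<i> * (of_real p' * cnj z - of_real p * cnj z')) 0 0)"
  using t by (simp add: kappa_quot_def corep_alpha_nf kappa_alpha_nf[OF assms] kappa_nf_eq Let_def
    complex_eq_iff field_simps power_numeral_reduce)

lemma regular_alpha_nf:
  assumes "c^2 = 1" and "t \<noteq> 0"
  shows "regular c (alpha_nf c t)"
  unfolding regular_def
proof (intro allI impI ballI)
  fix i j :: int and U V :: cmat assume ij: "i < 0" "j < 0" and "U \<in> grade i" "V \<in> grade j"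
  then have "U \<in> su21" "V \<in> su21" by (auto simp: grade_def)
  then show "kappa_quot c (alpha_nf c t) U V \<in> filt (i + j + 1)"
    using ij by (auto simp: su21_iff kappa_quot_alpha_nf[OF assms] Let_def filt_def forall_3)
qed

lemma trace_su_el: "trace (su_el 0 0 w 0 u ** su_el a z w' p u')
    = of_real (- 2 * Re w * Re z - 2 * Im w * Im z - u * p)"
  by (simp add: trace_def sum_3 mult3_entry complex_eq_iff)

text \<open>In real coordinates \<open>(Re z, Im z, p)\<close> on \<open>su21 / parab\<close> and
  \<open>(- 2 Re v, - 2 Im v, - f)\<close> on \<open>parab_plus\<close> the trace form is the dot product. So duality
  of the bases says that \<open>M N = 1\<close> for the two square coordinate matrices, and the stated sums are
  entries of \<open>N M = 1\<close>.\<close>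

lemma dual_bases_su_el:
  assumes "dual_bases X Z"
  obtains a z w p u v f where
    "\<And>k. X k = su_el (a k) (z k) (w k) (p k) (u k)"
    "\<And>k. Z k = su_el 0 0 (v k) 0 (f k)"
    "(\<Sum>k\<in>UNIV. Re (v k) * Re (z k)) = - 1 / 2" "(\<Sum>k\<in>UNIV. Im (v k) * Im (z k)) = - 1 / 2"
    "(\<Sum>k\<in>UNIV. Re (v k) * p k) = 0" "(\<Sum>k\<in>UNIV. Im (v k) * p k) = 0"
proof -
  have "\<forall>k. \<exists>a z w p u. X k = su_el a z w p u"
    using assms by (simp add: dual_bases_def su21_iff)
  then obtain a z w p u where X: "\<And>k. X k = su_el (a k) (z k) (w k) (p k) (u k)" by metis
  have "\<exists>v f. Z k = su_el 0 0 v 0 f" for k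
  proof -
    have Z: "Z k \<in> parab_plus" using assms by (simp add: dual_bases_def)
    then obtain b y v q f where "Z k = su_el b y v q f" by (auto simp: filt_def su21_iff)
    with Z show ?thesis by auto
  qed
  then obtain v f where Z: "\<And>k. Z k = su_el 0 0 (v k) 0 (f k)" by metis
  define M :: "real^3^3" where
    "M = (\<chi> k. vector [- 2 * Re (v k), - 2 * Im (v k), - f k])"
  define N :: "real^3^3" where
    "N = (\<chi> i l. vector [Re (z l), Im (z l), p l] $ i)"
  have "complex_of_real ((M ** N) $ j $ k) = trace (Z j ** X k)" for j k
    by (simp add: M_def N_def mult3_entry X Z trace_su_el)
  also have "\<dots> j k = of_real (if j = k then 1 else 0)" for j k
    using assms by (simp add: dual_bases_def)
  finally have "(M ** N) $ j $ k = (if j = k then 1 else 0)" for j k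
    by (simp only: of_real_eq_iff)
  then have "M ** N = mat 1" by (simp add: vec_eq_iff mat_def)
  then have NM: "N ** M = mat 1" by (simp add: matrix_left_right_inverse)
  have "(\<Sum>k\<in>UNIV. N $ i $ k * M $ k $ j) = (if i = j then 1 else 0)" for i j
    using arg_cong[OF NM, of "\<lambda>A. A $ i $ j"] by (simp add: matrix_matrix_mult_def mat_def)
  from this[of 1 1] this[of 2 2] this[of 3 1] this[of 3 2] show thesis
    by (intro that[OF X Z]) (simp_all add: M_def N_def sum_3 algebra_simps)
qed

text \<open>The curvature takes values in degree 1, so the brackets on the right-hand side lie in degree 2
  and the left-hand side lies in degree 1; each has to vanish. The left one is a multiple of
  \<open>\<Sum> p cnj v\<close>. The right one involves, besides \<open>\<Sum> v p\<close>, only the difference of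
  \<open>\<Sum> Re v Re z\<close> and \<open>\<Sum> Im v Im z\<close>, which are both \<open>- 1 / 2\<close>.\<close>

lemma normal_alpha_nf:
  assumes c: "c^2 = 1" and t: "t \<noteq> 0"
  shows "normal_ext c (alpha_nf c t)"
  unfolding normal_ext_def
proof (intro allI impI ballI)
  fix X Z U assume "dual_bases X Z" and "U \<in> su21"
  then obtain a z w p u v f b y x q g where
    X: "\<And>k. X k = su_el (a k) (z k) (w k) (p k) (u k)" and
    Z: "\<And>k. Z k = su_el 0 0 (v k) 0 (f k)" and
    U: "U = su_el b y x q g" and
    dual: "(\<Sum>k\<in>UNIV. Re (v k) * Re (z k)) = - 1 / 2" "(\<Sum>k\<in>UNIV. Im (v k) * Im (z k)) = - 1 / 2"
    "(\<Sum>k\<in>UNIV. Re (v k) * p k) = 0" "(\<Sum>k\<in>UNIV. Im (v k) * p k) = 0"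
    by (elim dual_bases_su_el) (auto simp: su21_iff)
  define C where "C = 3 * (1 - t^8) / (32 * t^4)"
  have vp: "(\<Sum>k\<in>UNIV. of_real (p k) * cnj (v k)) = 0"
    using dual(3,4) by (simp add: complex_eq_iff sum_3 mult.commute)
  have kq: "kappa_quot c (alpha_nf c t) (su_el a z w p u) (su_el a' z' w' p' u')
      = su_el 0 0 (of_real C * \<i> * (of_real p' * cnj z - of_real p * cnj z')) 0 0"
    for a z w p u a' z' w' p' u'
    by (simp add: kappa_quot_alpha_nf[OF c t] C_def Let_def)
  have lhs: "(\<Sum>k\<in>UNIV. kappa_quot c (alpha_nf c t) (lb (Z k) U) (X k))
      = su_el 0 0 (of_real (C * q) * (\<Sum>k\<in>UNIV. of_real (p k) * cnj (v k))) 0 0"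
    by (simp add: X Z U lb_su_el kq sum_3 su_el_add
        complex_eq_iff algebra_simps)
  have rhs: "(\<Sum>k\<in>UNIV. lb (Z k) (kappa_quot c (alpha_nf c t) U (X k)))
      = su_el 0 0 0 0 (2 * C * (q * (\<Sum>k\<in>UNIV. Re (v k) * Re (z k)) - q * (\<Sum>k\<in>UNIV. Im (v k) * Im (z k))
          - Re y * (\<Sum>k\<in>UNIV. Re (v k) * p k) + Im y * (\<Sum>k\<in>UNIV. Im (v k) * p k)))"
    by (simp add: X Z U lb_su_el kq sum_3 su_el_add
        complex_eq_iff algebra_simps)
  show "(\<Sum>k\<in>UNIV. kappa_quot c (alpha_nf c t) (lb (Z k) U) (X k))
      = 2 *\<^sub>R (\<Sum>k\<in>UNIV. lb (Z k) (kappa_quot c (alpha_nf c t) U (X k)))"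
    unfolding lhs rhs vp dual by (simp add: su_el_scaleR)
qed

lemma regular_normal_alpha_nf:
  assumes "c^2 = 1" and "t \<noteq> 0"
  shows "regular_normal_extension c (alpha_nf c t)"
  using assms
  by (simp add: regular_normal_extension_def extension_alpha_nf regular_alpha_nf normal_alpha_nf)

section \<open>The adjoint action and the groups G and P\<close>

lemma matrix_inv_works:
  assumes "det (A :: 'a::field^'n^'n) \<noteq> 0"
  shows "A ** matrix_inv A = mat 1" "matrix_inv A ** A = mat 1"
proof -
  obtain B where "A ** B = mat 1" "B ** A = mat 1"
    using assms by (auto simp: invertible_det_nz[symmetric] invertible_def)
  then have "matrix_inv A = B" "A ** B = mat 1" "B ** A = mat 1"
    by (auto intro: matrix_inv_unique)
  then show "A ** matrix_inv A = mat 1" "matrix_inv A ** A = mat 1" by simp_all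
qed

lemma matrix_inv_cancel:
  assumes "det (A :: 'a::field^'n^'n) \<noteq> 0"
  shows "A ** (matrix_inv A ** B) = B" "matrix_inv A ** (A ** B) = B"
  by (simp_all add: matrix_mul_assoc matrix_inv_works[OF assms])

lemma matrix_inv_inv:
  assumes "det (A :: 'a::field^'n^'n) \<noteq> 0"
  shows "matrix_inv (matrix_inv A) = A"
  by (rule matrix_inv_unique) (simp_all add: matrix_inv_works[OF assms])

lemma det_matrix_inv:
  assumes "det (A :: 'a::field^'n^'n) \<noteq> 0"
  shows "det A * det (matrix_inv A) = 1"
  using matrix_inv_works(1)[OF assms] by (metis det_I det_mul)

lemma matrix_inv_mult:
  assumes "det (A :: 'a::field^'n^'n) \<noteq> 0" "det B \<noteq> 0"
  shows "matrix_inv (A ** B) = matrix_inv B ** matrix_inv A"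
  by (rule matrix_inv_unique)
     (simp_all add: matrix_inv_works matrix_inv_cancel assms matrix_mul_assoc[symmetric])

lemma matrix_inv_commute:
  assumes d: "det (A :: 'a::field^'n^'n) \<noteq> 0" and "A ** B = B ** A"
  shows "matrix_inv A ** B = B ** matrix_inv A"
proof -
  have "matrix_inv A ** B = matrix_inv A ** ((B ** A) ** matrix_inv A)"
    by (simp only: matrix_mul_assoc[symmetric] matrix_inv_works[OF d] matrix_mul_rid)
  also have "\<dots> = matrix_inv A ** (A ** (B ** matrix_inv A))"
    by (simp only: assms(2)[symmetric] matrix_mul_assoc[symmetric])
  finally show ?thesis by (simp only: matrix_inv_cancel[OF d])
qed

lemma Ad_Ad:
  assumes "det (A :: 'a::field^'n^'n) \<noteq> 0" "det B \<noteq> 0"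
  shows "Ad A (Ad B X) = Ad (A ** B) X"
  by (simp add: Ad_def matrix_inv_mult assms matrix_mul_assoc)

lemma det_matrix_inv_nz: "det (A :: 'a::field^'n^'n) \<noteq> 0 \<Longrightarrow> det (matrix_inv A) \<noteq> 0"
  using det_matrix_inv by fastforce

lemma Ad_inv_mult:
  assumes "det (A :: 'a::field^'n^'n) \<noteq> 0" "det B \<noteq> 0"
  shows "Ad (matrix_inv (A ** B)) X = Ad (matrix_inv B) (Ad (matrix_inv A) X)"
  using assms by (simp add: Ad_Ad det_matrix_inv_nz matrix_inv_mult)

lemma Ad_inv_Ad:
  assumes d: "det (A :: 'a::field^'n^'n) \<noteq> 0"
  shows "Ad (matrix_inv A) (Ad A X) = X" "Ad A (Ad (matrix_inv A) X) = X"
  by (simp_all add: Ad_Ad d det_matrix_inv_nz matrix_inv_works)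

lemma Ad_mult:
  assumes "det (A :: 'a::field^'n^'n) \<noteq> 0"
  shows "Ad A X ** Ad A Y = Ad A (X ** Y)"
  by (simp add: Ad_def matrix_inv_cancel assms flip: matrix_mul_assoc)

lemma linear_Ad: "linear (Ad (A :: 'a::real_algebra_1^'n^'n))"
  by (rule linearI)
     (simp_all add: Ad_def vec_eq_iff matrix_matrix_mult_def sum.distrib scaleR_sum_right
       distrib_left distrib_right sum_distrib_right)

lemma Ad_lb:
  assumes "det (A :: 'a::real_normed_field^'n^'n) \<noteq> 0"
  shows "lb (Ad A X) (Ad A Y) = Ad A (lb X Y)"
  by (simp add: lb_def Ad_mult assms linear_diff[OF linear_Ad])

lemma trace_Ad:
  assumes "det (A :: 'a::field^'n^'n) \<noteq> 0"
  shows "trace (Ad A X) = trace X"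
proof -
  have "trace (Ad A X) = trace (matrix_inv A ** (A ** X))"
    unfolding Ad_def by (rule trace_mul_sym)
  then show ?thesis by (simp add: matrix_inv_cancel assms)
qed

lemma SU21_det: "q \<in> SU21 \<Longrightarrow> det q \<noteq> 0"
  by (auto simp: SU21_def)

lemma SU21_inv:
  assumes "q \<in> SU21" shows "matrix_inv q \<in> SU21"
proof -
  note d = SU21_det[OF assms]
  have "herm (matrix_inv q *v x) (matrix_inv q *v y)
      = herm (q *v (matrix_inv q *v x)) (q *v (matrix_inv q *v y))" for x y
    using assms by (simp add: SU21_def)
  then show ?thesis
    using det_matrix_inv[OF d] assms
    by (simp add: SU21_def matrix_vector_mul_assoc matrix_inv_works[OF d])
qed

lemma Pgrp_SU21: "q \<in> Pgrp \<Longrightarrow> q \<in> SU21"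
  by (simp add: Pgrp_def)

lemma Pgrp_iff: "q \<in> Pgrp \<longleftrightarrow> q \<in> SU21 \<and> q$2$1 = 0 \<and> q$3$1 = 0 \<and> q$3$2 = 0"
  by (auto simp: Pgrp_def forall_3)

lemma Pgrp_diag:
  assumes "q \<in> Pgrp" shows "q$1$1 \<noteq> 0" "q$2$2 \<noteq> 0" "q$3$3 \<noteq> 0"
  using assms SU21_det[OF Pgrp_SU21[OF assms]] by (auto simp: Pgrp_iff det_3)

text \<open>The diagonal entries of \<open>q\<close> are nonzero, so the entries of \<open>q\<^sup>-\<^sup>1 q = 1\<close> below the diagonal
  successively force those of \<open>q\<^sup>-\<^sup>1\<close> to vanish.\<close>

lemma Pgrp_inv:
  assumes "q \<in> Pgrp" shows "matrix_inv q \<in> Pgrp"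
proof -
  have "matrix_inv q ** q = mat 1"
    by (rule matrix_inv_works(2)[OF SU21_det[OF Pgrp_SU21[OF assms]]])
  then have "(matrix_inv q ** q) $ i $ j = mat 1 $ i $ j" for i j by simp
  from this[of 2 1] this[of 3 1] this[of 3 2] show ?thesis
    using assms Pgrp_diag[OF assms] SU21_inv[OF Pgrp_SU21[OF assms]]
    by (simp add: Pgrp_iff mult3_entry mat_def)
qed

lemma Pgrp_mult:
  assumes "p \<in> Pgrp" "q \<in> Pgrp" shows "p ** q \<in> Pgrp"
  using assms
  by (simp add: Pgrp_iff mult3_entry SU21_def det_mul matrix_vector_mul_assoc[symmetric])

lemma Ad_su21:
  assumes q: "q \<in> SU21" and A: "A \<in> su21" shows "Ad q A \<in> su21"
proof -
  note d = SU21_det[OF q]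
  have "herm (Ad q A *v x) y = herm (A *v (matrix_inv q *v x)) (matrix_inv q *v y)"
    and "herm x (Ad q A *v y) = herm (matrix_inv q *v x) (A *v (matrix_inv q *v y))" for x y
  proof -
    have q': "herm (q *v u) (q *v v) = herm u v" for u v using q by (simp add: SU21_def)
    have y: "q *v (matrix_inv q *v y) = y" for y
      by (simp add: matrix_vector_mul_assoc matrix_inv_works[OF d])
    show "herm (Ad q A *v x) y = herm (A *v (matrix_inv q *v x)) (matrix_inv q *v y)"
      by (subst q'[symmetric]) (simp only: y Ad_def matrix_vector_mul_assoc[symmetric])
    show "herm x (Ad q A *v y) = herm (matrix_inv q *v x) (A *v (matrix_inv q *v y))"
      by (subst q'[symmetric]) (simp only: y Ad_def matrix_vector_mul_assoc[symmetric])
  qed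
  then show ?thesis using A by (simp add: su21_def trace_Ad[OF d])
qed

text \<open>Conjugation by upper triangular matrices does not lower degrees: a nonzero term of the entry
  \<open>(i, j)\<close> comes from an entry \<open>(a, b)\<close> of \<open>A\<close> with \<open>i \<le> a\<close> and \<open>b \<le> j\<close>.\<close>

lemma Ad_filt:
  assumes q: "q \<in> Pgrp" and A: "A \<in> filt k" shows "Ad q A \<in> filt k"
proof -
  have "k \<le> pos j - pos i" if ne: "Ad q A $ i $ j \<noteq> 0" for i j
  proof -
    have "(\<Sum>b\<in>UNIV. (\<Sum>a\<in>UNIV. q $ i $ a * A $ a $ b) * matrix_inv q $ b $ j) \<noteq> 0"
      using ne by (simp add: Ad_def matrix_matrix_mult_def)
    then obtain b where "(\<Sum>a\<in>UNIV. q $ i $ a * A $ a $ b) * matrix_inv q $ b $ j \<noteq> 0"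
      by (rule sum.not_neutral_contains_not_neutral)
    then have b: "(\<Sum>a\<in>UNIV. q $ i $ a * A $ a $ b) \<noteq> 0" "matrix_inv q $ b $ j \<noteq> 0"
      by auto
    from b(1) obtain a where "q $ i $ a * A $ a $ b \<noteq> 0"
      by (rule sum.not_neutral_contains_not_neutral)
    then have "0 \<le> pos a - pos i" "k \<le> pos b - pos a"
      using q A by (auto simp: Pgrp_def filt_def)
    moreover have "0 \<le> pos j - pos b"
      using b(2) Pgrp_inv[OF q] by (simp add: Pgrp_def)
    ultimately show ?thesis by linarith
  qed
  then show ?thesis
    using A Ad_su21[OF Pgrp_SU21[OF q]] by (simp add: filt_def)
qed

lemma Ad_filt_iff:
  assumes q: "q \<in> Pgrp" shows "Ad q A \<in> filt k \<longleftrightarrow> A \<in> filt k"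
  using Ad_filt[OF q] Ad_filt[OF Pgrp_inv[OF q]]
    Ad_inv_Ad(1)[OF SU21_det[OF Pgrp_SU21[OF q]]] by metis

lemma Ggrp_det: "g \<in> Ggrp c \<Longrightarrow> det g \<noteq> 0"
  by (auto simp: Ggrp_def)

lemma Ggrp_mult:
  assumes "g \<in> Ggrp c" "k \<in> Ggrp c" shows "g ** k \<in> Ggrp c"
proof -
  have "transpose (g ** k) ** form c ** (g ** k)
      = transpose k ** (transpose g ** form c ** g) ** k"
    by (simp add: matrix_transpose_mul matrix_mul_assoc)
  then show ?thesis using assms by (simp add: Ggrp_def det_mul)
qed

lemma matrix_add_rdistrib: "(B + C) ** (A :: 'a::semiring_1^'n^'n) = B ** A + C ** A"
  by (simp add: matrix_matrix_mult_def vec_eq_iff sum.distrib distrib_right)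

text \<open>This equation, the derivative at \<open>1\<close> of the one defining \<open>Ggrp c\<close>, is visibly invariant under
  conjugation by \<open>Ggrp c\<close>.\<close>

lemma liealg_iff:
  assumes "c^2 = 1"
  shows "X \<in> liealg c \<longleftrightarrow> transpose X ** form c + form c ** X = 0"
proof
  have c: "c = 1 \<or> c = - 1" using assms by (simp add: power2_eq_1_iff)
  show "transpose X ** form c + form c ** X = 0" if "X \<in> liealg c"
    using that c by (auto elim!: liealgE simp: mat3_eq_iff mult3_entry form_def transpose_def)
  assume X: "transpose X ** form c + form c ** X = 0"
  have "X = elt c (X$1$2) (X$3$1) (X$3$2)"
    using c
  proof
    assume "c = 1"
    then show ?thesis using X
      by (simp add: mat3_eq_iff mult3_entry form_def transpose_def)
  next
    assume "c = - 1"
    then show ?thesis using X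
      by (simp add: mat3_eq_iff mult3_entry form_def transpose_def)
  qed
  then show "X \<in> liealg c" by (metis elt_in_liealg)
qed

lemma Ad_liealg:
  assumes c: "c^2 = 1" and g: "g \<in> Ggrp c" and X: "X \<in> liealg c"
  shows "Ad (matrix_inv g) X \<in> liealg c"
proof -
  note d = Ggrp_det[OF g]
  have G: "transpose g ** form c ** g = form c" using g by (simp add: Ggrp_def)
  have X': "transpose X ** form c + form c ** X = 0" using X liealg_iff[OF c] by simp
  let ?Y = "matrix_inv g ** X ** g"
  have "transpose ?Y ** form c = transpose g ** (transpose X ** form c) ** g"
  proof -
    have "transpose ?Y ** form c
        = transpose g ** transpose X ** (transpose (matrix_inv g) ** transpose g) ** form c ** g"
      by (subst G[symmetric]) (simp add: matrix_transpose_mul matrix_mul_assoc)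
    also have "transpose (matrix_inv g) ** transpose g = mat 1"
      by (simp add: matrix_inv_works[OF d] flip: matrix_transpose_mul)
    finally show ?thesis by (simp add: matrix_mul_assoc)
  qed
  moreover have "form c ** ?Y = transpose g ** (form c ** X) ** g"
    by (subst G[symmetric]) (simp add: matrix_inv_cancel[OF d] flip: matrix_mul_assoc)
  ultimately have "transpose ?Y ** form c + form c ** ?Y
      = transpose g ** (transpose X ** form c + form c ** X) ** g"
    by (simp add: matrix_add_ldistrib matrix_add_rdistrib)
  also have "\<dots> = 0" by (simp add: X')
  finally show ?thesis using liealg_iff[OF c] by (simp add: Ad_def matrix_inv_inv[OF d])
qed

lemma Ggrp_inv:
  assumes g: "g \<in> Ggrp c" shows "matrix_inv g \<in> Ggrp c"
proof -
  note d = Ggrp_det[OF g]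
  have G: "transpose g ** form c ** g = form c" using g by (simp add: Ggrp_def)
  have "transpose (matrix_inv g) ** form c ** matrix_inv g
      = transpose (matrix_inv g) ** transpose g ** form c ** (g ** matrix_inv g)"
    by (subst G[symmetric]) (simp add: matrix_mul_assoc)
  also have "transpose (matrix_inv g) ** transpose g = mat 1"
    by (simp add: matrix_inv_works[OF d] flip: matrix_transpose_mul)
  finally show ?thesis
    using det_matrix_inv[OF d] g by (simp add: Ggrp_def matrix_inv_works[OF d])
qed

section \<open>Gauge transformations\<close>

text \<open>The pairs for which \<open>(k, p) \<mapsto> (k g, q p)\<close> descends from \<open>G \<times> P\<close> to the bundle
  \<open>G \<times>\<^sub>\<iota> P\<close>.\<close>

definition gauge :: "real \<Rightarrow> rmat \<Rightarrow> cmat \<Rightarrow> bool" where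
  "gauge c g q \<longleftrightarrow> g \<in> Ggrp c \<and> g ** hsym = hsym ** g \<and>
     q \<in> Pgrp \<and> q ** iota hsym = iota hsym ** q"

text \<open>The linear map whose form is the pullback of \<open>\<omega>\<^sub>\<alpha>\<close> along \<open>(k, p) \<mapsto> (k g, q p)\<close>.\<close>

definition transform :: "rmat \<Rightarrow> cmat \<Rightarrow> (rmat \<Rightarrow> cmat) \<Rightarrow> rmat \<Rightarrow> cmat" where
  "transform g q \<alpha> X = Ad (matrix_inv q) (\<alpha> (Ad (matrix_inv g) X))"

lemma gauge_det: "gauge c g q \<Longrightarrow> det g \<noteq> 0" "gauge c g q \<Longrightarrow> det q \<noteq> 0"
  by (auto simp: gauge_def Ggrp_det SU21_det Pgrp_SU21)

lemma gauge_mult: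
  assumes "gauge c g q" "gauge c g' q'" shows "gauge c (g ** g') (q ** q')"
  using assms unfolding gauge_def
  by (metis Ggrp_mult Pgrp_mult matrix_mul_assoc)

lemma transform_transform:
  assumes "gauge c g q" "gauge c g' q'"
  shows "transform g q (transform g' q' \<alpha>) = transform (g ** g') (q' ** q) \<alpha>"
  using gauge_det[OF assms(1)] gauge_det[OF assms(2)]
  by (intro ext) (simp add: transform_def Ad_inv_mult)

lemma Ck_const: "Ck k U (\<lambda>_. b)"
proof (induction k arbitrary: b)
  case (Suc k)
  show ?case by (auto intro!: exI[of _ "\<lambda>_ _. 0"] Suc)
qed simp

text \<open>The derivative of a linear map is constant, so all higher derivatives vanish.\<close>

lemma smooth_on_linear:
  assumes "linear F" shows "smooth_on UNIV F"
proof -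
  have F: "bounded_linear F" using assms by (simp add: linear_conv_bounded_linear)
  have "Ck k UNIV F" for k
    by (cases k) (auto intro!: exI[of _ "\<lambda>_. F"] Ck_const bounded_linear_imp_has_derivative F
        linear_continuous_on)
  then show ?thesis by (simp add: smooth_on_def)
qed

lemma proj_gauge:
  assumes "gauge c g q"
  shows "proj (g\<^sub>1 ** g, q ** p) = (\<lambda>(g\<^sub>1, p). (g\<^sub>1 ** g, q ** p)) ` proj (g\<^sub>1, p)"
proof -
  have k: "k ** g = g ** k \<and> matrix_inv (iota k) ** q = q ** matrix_inv (iota k)" if "k \<in> Kgrp" for k
    using that assms by (auto simp: Kgrp_def gauge_def iota_simps(1) matrix_inv_simps)
  have "(g\<^sub>1 ** g ** k, matrix_inv (iota k) ** (q ** p))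
      = (\<lambda>(g\<^sub>1, p). (g\<^sub>1 ** g, q ** p)) (g\<^sub>1 ** k, matrix_inv (iota k) ** p)" if "k \<in> Kgrp" for k
    using k[OF that] by (simp add: matrix_mul_assoc) (simp flip: matrix_mul_assoc)
  then show ?thesis
    by (auto simp: proj_def image_def) metis+
qed

text \<open>The map \<open>F\<close> covering the morphism is linear, hence is its own derivative; evaluating
  \<open>omega \<alpha>\<close> at \<open>F x\<close> on the image of a tangent vector \<open>(k X, p Y)\<close> conjugates \<open>X\<close> by \<open>g\<^sup>-\<^sup>1\<close>
  before \<open>\<alpha>\<close> and by \<open>(q p)\<^sup>-\<^sup>1\<close> after it.\<close>

lemma equivalent_transform:
  assumes G: "gauge c g q" and eq: "\<And>X. X \<in> liealg c \<Longrightarrow> \<beta> X = transform g q \<alpha> X"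
  shows "equivalent c \<alpha> \<beta>"
proof -
  define F where "F = (\<lambda>(g\<^sub>1 :: rmat, p :: cmat). (g\<^sub>1 ** g, q ** p))"
  have "linear F"
    by (rule linearI)
       (auto simp: F_def matrix_add_ldistrib matrix_add_rdistrib vec_eq_iff matrix_matrix_mult_def
         sum.distrib scaleR_sum_right sum_distrib_left algebra_simps)
  then have bl: "bounded_linear F" by (simp add: linear_conv_bounded_linear)
  note dg = gauge_det(1)[OF G] and dq = gauge_det(2)[OF G]
  have F_in: "F x \<in> Ggrp c \<times> Pgrp" if "x \<in> Ggrp c \<times> Pgrp" for x
    using that G by (auto simp: F_def gauge_def Ggrp_mult Pgrp_mult)
  have F_proj: "proj (F x) = F ` proj x" for x
    using proj_gauge[OF G] by (cases x) (simp add: F_def)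
  have lift: "local_lift c ((`) F) UNIV F"
    using smooth_on_linear[OF \<open>linear F\<close>] F_in F_proj by (simp add: local_lift_def)
  have "bundle_morphism c ((`) F)"
    unfolding bundle_morphism_def
  proof (intro conjI ballI)
    show "(`) F ` bundle_space c \<subseteq> bundle_space c"
      using F_in by (auto simp: bundle_space_def F_proj[symmetric])
  next
    fix u r
    show "F ` ract u r = ract (F ` u) r"
      by (auto simp: ract_def F_def image_image case_prod_beta matrix_mul_assoc)
  qed (use lift in blast)
  moreover have "pullback_eq c ((`) F) \<alpha> \<beta>"
    unfolding pullback_eq_def
  proof
    fix x assume x: "x \<in> Ggrp c \<times> Pgrp"
    have dF: "frechet_derivative F (at x) = F"
      using bounded_linear_imp_has_derivative[OF bl] frechet_derivative_at by metis
    have "omega \<alpha> (F x) (F w) = omega \<beta> x w" if w: "w \<in> tangent c x" for w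
    proof -
      obtain g\<^sub>1 p X Y where xw: "x = (g\<^sub>1, p)" "w = (g\<^sub>1 ** X, p ** Y)" and X: "X \<in> liealg c"
        using w by (cases x) (auto simp: tangent_def)
      have d: "det g\<^sub>1 \<noteq> 0" "det p \<noteq> 0"
        using x by (auto simp: xw Ggrp_det SU21_det Pgrp_SU21)
      have "matrix_inv (g\<^sub>1 ** g) ** (g\<^sub>1 ** X ** g) = Ad (matrix_inv g) X"
        by (simp add: Ad_def matrix_inv_mult dg d matrix_inv_inv matrix_inv_cancel
            flip: matrix_mul_assoc)
      moreover have "Ad (matrix_inv (q ** p)) A = Ad (matrix_inv p) (Ad (matrix_inv q) A)" for A
        by (rule Ad_inv_mult[OF dq d(2)])
      moreover have "matrix_inv (q ** p) ** (q ** (p ** Y)) = Y" "matrix_inv p ** (p ** Y) = Y"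
        "matrix_inv g\<^sub>1 ** (g\<^sub>1 ** X) = X"
        by (simp_all add: matrix_inv_mult d dq matrix_inv_cancel flip: matrix_mul_assoc)
      ultimately show ?thesis
        by (simp add: xw F_def omega_def eq[OF X] transform_def)
    qed
    then show "\<exists>U Fa. x \<in> U \<and> local_lift c ((`) F) U Fa \<and>
        (\<forall>w\<in>tangent c x. omega \<alpha> (Fa x) (frechet_derivative Fa (at x) w) = omega \<beta> x w)"
      using lift dF
      by (intro exI[of _ UNIV] exI[of _ F]) simp
  qed
  ultimately show ?thesis unfolding equivalent_def by blast
qed

lemma extension_transform:
  assumes c: "c^2 = 1" and G: "gauge c g q" and ext: "extension c \<alpha>"
  shows "extension c (transform g q \<alpha>)"
proof -
  note dg = gauge_det(1)[OF G] and dq = gauge_det(2)[OF G]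
  have dg': "det (matrix_inv g) \<noteq> 0" and dq': "det (matrix_inv q) \<noteq> 0"
    by (rule det_matrix_inv_nz[OF dg], rule det_matrix_inv_nz[OF dq])
  have g: "g \<in> Ggrp c" and q: "q \<in> Pgrp" using G by (auto simp: gauge_def)
  have gX: "Ad (matrix_inv g) X \<in> liealg c" if "X \<in> liealg c" for X
    by (rule Ad_liealg[OF c g that])
  have gX': "Ad g X \<in> liealg c" if "X \<in> liealg c" for X
    using Ad_liealg[OF c Ggrp_inv[OF g] that] by (simp add: matrix_inv_inv[OF dg])
  show ?thesis
    unfolding extension_def
  proof (intro conjI ballI allI)
    show "transform g q \<alpha> ` liealg c \<subseteq> su21"
      using ext gX Ad_su21[OF Pgrp_SU21[OF Pgrp_inv[OF q]]]
      by (auto simp: extension_def transform_def)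
  next
    fix X Y a b assume "X \<in> liealg c" "Y \<in> liealg c"
    then show "transform g q \<alpha> (a *\<^sub>R X + b *\<^sub>R Y)
        = a *\<^sub>R transform g q \<alpha> X + b *\<^sub>R transform g q \<alpha> Y"
      using ext gX by (simp add: extension_def transform_def linear_add[OF linear_Ad] linear_scale[OF linear_Ad])
  next
    fix k X assume k: "k \<in> Kgrp" and X: "X \<in> liealg c"
    have dk: "det k \<noteq> 0" "det (iota k) \<noteq> 0"
    proof -
      have "det hsym = 1" "det (iota hsym) = 1"
        by (simp_all add: det_3 iota_simps(2)) (simp add: hsym_def)
      then show "det k \<noteq> 0" "det (iota k) \<noteq> 0" using k by (auto simp: Kgrp_def iota_simps(1))
    qed
    have cg: "matrix_inv g ** k = k ** matrix_inv g" "matrix_inv q ** iota k = iota k ** matrix_inv q"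
      using k G
      by (auto simp: Kgrp_def gauge_def iota_simps(1)
          intro!: matrix_inv_commute[OF dg] matrix_inv_commute[OF dq])
    have "Ad (matrix_inv g) (Ad k X) = Ad k (Ad (matrix_inv g) X)"
      by (simp add: Ad_Ad dg' dk cg)
    moreover have "\<alpha> (Ad k (Ad (matrix_inv g) X)) = Ad (iota k) (\<alpha> (Ad (matrix_inv g) X))"
      using ext k gX[OF X] by (simp add: extension_def)
    moreover have "Ad (matrix_inv q) (Ad (iota k) A) = Ad (iota k) (Ad (matrix_inv q) A)" for A
      by (simp add: Ad_Ad dq' dk cg)
    ultimately show "transform g q \<alpha> (Ad k X) = Ad (iota k) (transform g q \<alpha> X)"
      by (simp add: transform_def)
  next
    fix U assume "U \<in> su21"
    then have "Ad q U \<in> su21" by (rule Ad_su21[OF Pgrp_SU21[OF q]])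
    then have ex1: "\<exists>!X. X \<in> liealg c \<and> \<alpha> X - Ad q U \<in> parab"
      using ext by (simp add: extension_def)
    have iff: "transform g q \<alpha> X - U \<in> parab \<longleftrightarrow> \<alpha> (Ad (matrix_inv g) X) - Ad q U \<in> parab" for X
    proof -
      have "transform g q \<alpha> X - U = Ad (matrix_inv q) (\<alpha> (Ad (matrix_inv g) X) - Ad q U)"
        by (simp add: transform_def linear_diff[OF linear_Ad] Ad_inv_Ad[OF dq])
      then show ?thesis by (simp add: Ad_filt_iff[OF Pgrp_inv[OF q]])
    qed
    show "\<exists>!X. X \<in> liealg c \<and> transform g q \<alpha> X - U \<in> parab"
      unfolding iff using ex1 gX gX' Ad_inv_Ad[OF dg] by metis
  qed
qed

lemma kappa_transform:
  assumes G: "gauge c g q"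
  shows "kappa (transform g q \<alpha>) X Y
    = Ad (matrix_inv q) (kappa \<alpha> (Ad (matrix_inv g) X) (Ad (matrix_inv g) Y))"
  using gauge_det[OF G]
  by (simp add: kappa_def transform_def linear_diff[OF linear_Ad] Ad_lb det_matrix_inv_nz)

lemma corep_properties:
  assumes "extension c \<alpha>" "U \<in> su21"
  shows "corep c \<alpha> U \<in> liealg c" "\<alpha> (corep c \<alpha> U) - U \<in> parab"
  using theI'[of "\<lambda>X. X \<in> liealg c \<and> \<alpha> X - U \<in> parab"] assms
  unfolding corep_def extension_def by auto

lemma kappa_quot_transform:
  assumes c: "c^2 = 1" and G: "gauge c g q" and ext: "extension c \<alpha>"
    and U: "U \<in> su21" and V: "V \<in> su21"
  shows "kappa_quot c (transform g q \<alpha>) U V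
    = Ad (matrix_inv q) (kappa_quot c \<alpha> (Ad q U) (Ad q V))"
proof -
  note dg = gauge_det(1)[OF G] and dq = gauge_det(2)[OF G]
  have g: "g \<in> Ggrp c" and q: "q \<in> Pgrp" using G by (auto simp: gauge_def)
  have "Ad (matrix_inv g) (corep c (transform g q \<alpha>) U) = corep c \<alpha> (Ad q U)" if U: "U \<in> su21" for U
  proof (rule corep_eqI[OF ext, symmetric])
    note * = corep_properties[OF extension_transform[OF c G ext] U]
    show "Ad q U \<in> su21" by (rule Ad_su21[OF Pgrp_SU21[OF q] U])
    show "Ad (matrix_inv g) (corep c (transform g q \<alpha>) U) \<in> liealg c"
      by (rule Ad_liealg[OF c g *(1)])
    have "\<alpha> (Ad (matrix_inv g) (corep c (transform g q \<alpha>) U)) - Ad q U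
        = Ad q (transform g q \<alpha> (corep c (transform g q \<alpha>) U) - U)"
      by (simp add: transform_def linear_diff[OF linear_Ad] Ad_inv_Ad[OF dq])
    then show "\<alpha> (Ad (matrix_inv g) (corep c (transform g q \<alpha>) U)) - Ad q U \<in> parab"
      using *(2) by (simp add: Ad_filt[OF q])
  qed
  then show ?thesis using U V by (simp add: kappa_quot_def kappa_transform[OF G])
qed

text \<open>Conjugation by \<open>q\<close> preserves brackets, the trace form and \<open>parab_plus\<close>, so it maps dual bases
  to dual bases; the condition for the new map is the image under \<open>Ad(q)\<^sup>-\<^sup>1\<close> of the condition for
  \<open>\<alpha>\<close> at the transported bases.\<close>

lemma normal_transform:
  assumes c: "c^2 = 1" and G: "gauge c g q" and ext: "extension c \<alpha>" and nor: "normal_ext c \<alpha>"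
  shows "normal_ext c (transform g q \<alpha>)"
  unfolding normal_ext_def
proof (intro allI impI ballI)
  fix X Z U assume dual: "dual_bases X Z" and U: "U \<in> su21"
  note dq = gauge_det(2)[OF G]
  have dq': "det (matrix_inv q) \<noteq> 0" by (rule det_matrix_inv_nz[OF dq])
  have q: "q \<in> Pgrp" using G by (auto simp: gauge_def)
  note su = Ad_su21[OF Pgrp_SU21[OF q]]
  have X: "X k \<in> su21" and Z: "Z k \<in> su21" for k
    using dual by (auto simp: dual_bases_def filt_def)
  have ZU: "lb (Z k) U \<in> su21" for k
    using Z[of k] U by (auto simp: su21_iff lb_su_el)
  have "dual_bases (\<lambda>k. Ad q (X k)) (\<lambda>k. Ad q (Z k))"
    using dual by (simp add: dual_bases_def su Ad_filt[OF q] Ad_mult[OF dq] trace_Ad[OF dq])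
  then have "(\<Sum>k\<in>UNIV. kappa_quot c \<alpha> (lb (Ad q (Z k)) (Ad q U)) (Ad q (X k)))
      = 2 *\<^sub>R (\<Sum>k\<in>UNIV. lb (Ad q (Z k)) (kappa_quot c \<alpha> (Ad q U) (Ad q (X k))))"
    using nor su[OF U] unfolding normal_ext_def by blast
  then have "(\<Sum>k\<in>UNIV. Ad (matrix_inv q) (kappa_quot c \<alpha> (Ad q (lb (Z k) U)) (Ad q (X k))))
      = 2 *\<^sub>R (\<Sum>k\<in>UNIV. Ad (matrix_inv q) (lb (Ad q (Z k)) (kappa_quot c \<alpha> (Ad q U) (Ad q (X k)))))"
    by (simp add: Ad_lb[OF dq] linear_sum[OF linear_Ad, symmetric] linear_scale[OF linear_Ad, symmetric])
  then show "(\<Sum>k\<in>UNIV. kappa_quot c (transform g q \<alpha>) (lb (Z k) U) (X k))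
      = 2 *\<^sub>R (\<Sum>k\<in>UNIV. lb (Z k) (kappa_quot c (transform g q \<alpha>) U (X k)))"
    by (simp add: kappa_quot_transform[OF c G ext] X ZU U Ad_lb[OF dq', symmetric] Ad_inv_Ad[OF dq])
qed

section \<open>Extensions in coordinates\<close>

text \<open>The symmetry fixes \<open>(1, 0, 0)\<close> and \<open>\<iota>(h)\<close> negates the odd coordinates \<open>z, w\<close>, so these vanish
  there; on \<open>\<mm>\<close> the symmetry is \<open>-1\<close>, so the even coordinates vanish. Surjectivity onto
  \<open>su21 / parab\<close> makes \<open>z1, z2\<close> span the complex plane over the reals.\<close>

lemma extension_coords:
  assumes ext: "extension c \<alpha>"
  obtains a z1 z2 w1 w2 p u where
    "\<And>e x1 x2. \<alpha> (elt c e x1 x2) = su_el (of_real e * a) (of_real x1 * z1 + of_real x2 * z2)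
       (of_real x1 * w1 + of_real x2 * w2) (e * p) (e * u)"
    "Im (cnj z1 * z2) \<noteq> 0"
proof -
  have su: "\<alpha> (elt c e x1 x2) \<in> su21" for e x1 x2
    using ext by (auto simp: extension_def)
  have lin: "\<alpha> (r *\<^sub>R X + s *\<^sub>R Y) = r *\<^sub>R \<alpha> X + s *\<^sub>R \<alpha> Y" if "X \<in> liealg c" "Y \<in> liealg c" for r s X Y
    using ext that by (simp add: extension_def)
  have equiv: "\<alpha> (elt c e (- x1) (- x2)) = Ad (iota hsym) (\<alpha> (elt c e x1 x2))" for e x1 x2
    using ext by (force simp: extension_def Kgrp_def Ad_hsym_elt[symmetric])
  obtain a z w p u where E: "\<alpha> (elt c 1 0 0) = su_el a z w p u"
    using su[of 1 0 0] by (auto simp: su21_iff)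
  then have "z = 0" "w = 0"
    using equiv[of 1 0 0] by (auto simp: Ad_iota_hsym_su_el)
  have odd: "\<exists>z w. \<alpha> (elt c 0 x1 x2) = su_el 0 z w 0 0" for x1 x2
  proof -
    obtain a z w p u where X: "\<alpha> (elt c 0 x1 x2) = su_el a z w p u"
      using su[of 0 x1 x2] by (auto simp: su21_iff)
    have "\<alpha> (elt c 0 (- x1) (- x2)) = (- 1) *\<^sub>R \<alpha> (elt c 0 x1 x2)"
      using lin[of "elt c 0 x1 x2" "elt c 0 0 0" "- 1" 0] by (simp add: elt_scaleR elt_add)
    then show ?thesis
      using equiv[of 0 x1 x2] by (auto simp: X Ad_iota_hsym_su_el su_el_scaleR)
  qed
  obtain z1 w1 where X1: "\<alpha> (elt c 0 1 0) = su_el 0 z1 w1 0 0" using odd by blast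
  obtain z2 w2 where X2: "\<alpha> (elt c 0 0 1) = su_el 0 z2 w2 0 0" using odd by blast
  have coords: "\<alpha> (elt c e x1 x2) = su_el (of_real e * a) (of_real x1 * z1 + of_real x2 * z2)
       (of_real x1 * w1 + of_real x2 * w2) (e * p) (e * u)" for e x1 x2
  proof -
    have "elt c e x1 x2 = 1 *\<^sub>R (x1 *\<^sub>R elt c 0 1 0 + x2 *\<^sub>R elt c 0 0 1) + e *\<^sub>R elt c 1 0 0"
      by (simp add: elt_scaleR elt_add)
    also have "\<alpha> \<dots> = 1 *\<^sub>R \<alpha> (x1 *\<^sub>R elt c 0 1 0 + x2 *\<^sub>R elt c 0 0 1) + e *\<^sub>R \<alpha> (elt c 1 0 0)"
      by (rule lin) (simp_all add: elt_scaleR elt_add)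
    also have "\<alpha> (x1 *\<^sub>R elt c 0 1 0 + x2 *\<^sub>R elt c 0 0 1)
        = x1 *\<^sub>R \<alpha> (elt c 0 1 0) + x2 *\<^sub>R \<alpha> (elt c 0 0 1)"
      by (rule lin) simp_all
    finally show ?thesis
      by (simp add: E X1 X2 \<open>z = 0\<close> \<open>w = 0\<close> su_el_scaleR su_el_add complex_eq_iff)
  qed
  have onto: "\<exists>x1 x2. of_real x1 * z1 + of_real x2 * z2 = y" for y
  proof -
    have "\<exists>X. X \<in> liealg c \<and> \<alpha> X - su_el 0 y 0 0 0 \<in> parab"
      using ext unfolding extension_def by (blast intro: su_el_in_su21)
    then obtain e x1 x2 where "\<alpha> (elt c e x1 x2) - su_el 0 y 0 0 0 \<in> parab"
      by (auto elim!: liealgE)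
    then have "of_real x1 * z1 + of_real x2 * z2 - y = 0" by (simp add: coords su_el_diff)
    then show ?thesis by auto
  qed
  (* 1 and i have area 1, and this area is the area of z1, z2 times a determinant *)
  obtain x1 x2 where x: "of_real x1 * z1 + of_real x2 * z2 = 1" using onto by blast
  obtain y1 y2 where y: "of_real y1 * z1 + of_real y2 * z2 = \<i>" using onto by blast
  have "(x1 * y2 - x2 * y1) * Im (cnj z1 * z2)
      = Im (cnj (of_real x1 * z1 + of_real x2 * z2) * (of_real y1 * z1 + of_real y2 * z2))"
    by (simp add: algebra_simps)
  then have "(x1 * y2 - x2 * y1) * Im (cnj z1 * z2) = 1" by (simp add: x y)
  then have "Im (cnj z1 * z2) \<noteq> 0" by auto
  with coords show thesis by (rule that)
qed

text \<open>Regularity for \<open>i = j = -1\<close> forbids a component of degree \<open>-2\<close> in the curvature of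
  \<open>(0, 1, 0)\<close> and \<open>(0, 0, 1)\<close>, that is, it forces the entry (3,1) of \<open>\<alpha>\<close> on their bracket
  \<open>(-1, 0, 0)\<close> to agree with that of the bracket of their images.\<close>

lemma regular_coords:
  assumes c: "c^2 = 1" and ext: "extension c \<alpha>" and reg: "regular c \<alpha>"
    and coords: "\<And>e x1 x2. \<alpha> (elt c e x1 x2) = su_el (of_real e * a) (of_real x1 * z1 + of_real x2 * z2)
       (of_real x1 * w1 + of_real x2 * w2) (e * p) (e * u)"
  shows "p = 2 * Im (cnj z1 * z2)"
proof -
  have grade: "su_el 0 y 0 0 0 \<in> grade (- 1)" for y
    by (simp add: grade_def forall_3)
  have "corep c \<alpha> (su_el 0 z1 0 0 0) = elt c 0 1 0" "corep c \<alpha> (su_el 0 z2 0 0 0) = elt c 0 0 1"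
    by (rule corep_eqI[OF ext]; simp add: coords su_el_diff)+
  then have "kappa \<alpha> (elt c 0 1 0) (elt c 0 0 1) \<in> filt (- 1 + - 1 + 1)"
    using reg grade[of z1] grade[of z2] unfolding regular_def kappa_quot_def by force
  then have "kappa \<alpha> (elt c 0 1 0) (elt c 0 0 1) $ 3 $ 1 \<noteq> 0 \<longrightarrow> - 1 + - 1 + 1 \<le> pos 1 - pos 3"
    unfolding filt_def by blast
  then have "kappa \<alpha> (elt c 0 1 0) (elt c 0 0 1) $ 3 $ 1 = 0" by simp
  then show ?thesis
    by (simp add: kappa_def coords lb_su_el lb_elt[OF c] su_el_diff complex_eq_iff)
qed

section \<open>Reduction of the entries in negative degree\<close>

text \<open>The matrix with rows \<open>(m, n)\<close> and \<open>(- c n, m)\<close> is a rotation for \<open>c = 1\<close> and a hyperbolic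
  rotation for \<open>c = -1\<close>; it is to diagonalize the quadratic form \<open>P x\<^sup>2 + 2 Q x y + S y\<^sup>2\<close>. The
  off-diagonal entry is a combination of the sine and the cosine (hyperbolic if \<open>c = -1\<close>) of twice
  the angle. In the hyperbolic case it can be made zero because \<open>|2 Q| < P + S\<close>; in the other case
  the angle is chosen such that the larger eigenvalue comes first, which makes \<open>t \<ge> 1\<close>.\<close>

lemma diagonalize_pair:
  fixes P Q S :: real
  assumes c: "c^2 = 1" and pos: "0 < P" "0 < S" "Q^2 < P * S"
  obtains m n where "m^2 + c * n^2 = 1" "Q * (m^2 - c * n^2) + (S - c * P) * m * n = 0"
    "c = 1 \<Longrightarrow> P * n^2 - 2 * Q * m * n + S * m^2 \<le> P * m^2 + 2 * Q * m * n + S * n^2"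
proof -
  consider "c = 1" | "c = - 1" using c by (auto simp: power2_eq_1_iff)
  then show thesis
  proof cases
    case 1
    define \<theta> where "\<theta> = Arg (Complex (P - S) (2 * Q)) / 2"
    define \<rho> where "\<rho> = cmod (Complex (P - S) (2 * Q))"
    have "Complex (P - S) (2 * Q) = rcis \<rho> (2 * \<theta>)"
      by (simp add: \<rho>_def \<theta>_def rcis_cmod_Arg)
    then have PS: "P - S = \<rho> * cos (2 * \<theta>)" and Q: "2 * Q = \<rho> * sin (2 * \<theta>)"
      by (simp_all add: complex_eq_iff)
    have cs: "(cos \<theta>)^2 - (sin \<theta>)^2 = cos (2 * \<theta>)" "2 * (cos \<theta> * sin \<theta>) = sin (2 * \<theta>)"
      by (simp_all add: cos_double sin_double)
    show thesis
    proof (rule that)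
      show "(cos \<theta>)^2 + c * (sin \<theta>)^2 = 1" using 1 by simp
      have "2 * (Q * ((cos \<theta>)^2 - (sin \<theta>)^2) - (P - S) * (cos \<theta> * sin \<theta>))
          = (2 * Q) * cos (2 * \<theta>) - (P - S) * sin (2 * \<theta>)"
        by (simp add: cs(1)) (simp add: cs(2)[symmetric])
      also have "\<dots> = 0" by (simp add: PS Q)
      finally show "Q * ((cos \<theta>)^2 - c * (sin \<theta>)^2) + (S - c * P) * cos \<theta> * sin \<theta> = 0"
        using 1 by (simp add: algebra_simps)
      have "(P * (cos \<theta>)^2 + 2 * Q * cos \<theta> * sin \<theta> + S * (sin \<theta>)^2)
          - (P * (sin \<theta>)^2 - 2 * Q * cos \<theta> * sin \<theta> + S * (cos \<theta>)^2)
        = (P - S) * ((cos \<theta>)^2 - (sin \<theta>)^2) + (2 * Q) * (2 * (cos \<theta> * sin \<theta>))"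
        by (simp add: algebra_simps)
      also have "\<dots> = \<rho> * ((cos (2 * \<theta>))^2 + (sin (2 * \<theta>))^2)"
        unfolding cs PS Q by algebra
      also have "\<dots> \<ge> 0" by (simp add: \<rho>_def)
      finally show "P * (sin \<theta>)^2 - 2 * Q * cos \<theta> * sin \<theta> + S * (cos \<theta>)^2
          \<le> P * (cos \<theta>)^2 + 2 * Q * cos \<theta> * sin \<theta> + S * (sin \<theta>)^2" by simp
    qed
  next
    case 2
    have "4 * (P * S) \<le> (P + S)^2"
      using zero_le_power2[of "P - S"] by (simp add: power2_eq_square algebra_simps)
    then have pos': "0 < (P + S)^2 - 4 * Q^2" using pos by simp
    define \<Delta> where "\<Delta> = sqrt ((P + S)^2 - 4 * Q^2)"
    have \<Delta>: "0 < \<Delta>" "\<Delta>^2 = (P + S)^2 - 4 * Q^2" using pos' by (simp_all add: \<Delta>_def)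
    define \<theta> where "\<theta> = arsinh (- 2 * Q / \<Delta>) / 2"
    have sinh: "sinh (2 * \<theta>) = - 2 * Q / \<Delta>" by (simp add: \<theta>_def)
    have "(cosh (2 * \<theta>))^2 = ((P + S) / \<Delta>)^2"
      using \<Delta> unfolding cosh_square_eq sinh power_divide by (simp add: field_simps)
    then have cosh: "cosh (2 * \<theta>) = (P + S) / \<Delta>"
      using pos \<Delta>(1) by (simp add: power2_eq_iff_nonneg)
    have cs: "(cosh \<theta>)^2 + (sinh \<theta>)^2 = cosh (2 * \<theta>)" "2 * (cosh \<theta> * sinh \<theta>) = sinh (2 * \<theta>)"
      by (simp_all add: cosh_double sinh_double)
    show thesis
    proof (rule that)
      show "(cosh \<theta>)^2 + c * (sinh \<theta>)^2 = 1" using 2 by (simp add: cosh_square_eq)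
      have "2 * (Q * ((cosh \<theta>)^2 + (sinh \<theta>)^2) + (P + S) * (cosh \<theta> * sinh \<theta>))
          = 2 * Q * cosh (2 * \<theta>) + (P + S) * sinh (2 * \<theta>)"
        by (simp add: cs(1)) (simp add: cs(2)[symmetric])
      also have "\<dots> = 0" by (simp add: sinh cosh)
      finally show "Q * ((cosh \<theta>)^2 - c * (sinh \<theta>)^2) + (S - c * P) * cosh \<theta> * sinh \<theta> = 0"
        using 2 by (simp add: algebra_simps)
    qed (use 2 in simp)
  qed
qed

text \<open>The degree 0 part of \<open>P\<close>, parametrized by \<open>a\<close>, multiplies the entry (2,1) by \<open>a\<^sup>2 / cnj a\<close>. As
  \<open>a\<close> has a third of the required argument, every factor occurs.\<close>

lemma scale_to_one:
  fixes \<zeta> :: complex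
  assumes "\<zeta> \<noteq> 0"
  obtains a where "a \<noteq> 0" "a^2 * \<zeta> = cnj a"
proof
  define r \<phi> where "r = cmod \<zeta>" and "\<phi> = Arg \<zeta>"
  have \<zeta>: "\<zeta> = rcis r \<phi>" by (simp add: r_def \<phi>_def rcis_cmod_Arg)
  have "r \<noteq> 0" using assms by (simp add: r_def)
  then show "rcis (1 / r) (- (\<phi> / 3)) \<noteq> 0" by simp
  have "(rcis (1 / r) (- (\<phi> / 3)))^2 * \<zeta> = rcis (1 / r) (\<phi> / 3)"
    using \<open>r \<noteq> 0\<close> by (simp add: \<zeta> rcis_mult power2_eq_square)
  then show "(rcis (1 / r) (- (\<phi> / 3)))^2 * \<zeta> = cnj (rcis (1 / r) (- (\<phi> / 3)))"
    by (simp add: rcis_def cis_cnj)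
qed

text \<open>The element \<open>g\<close> of \<open>G\<close> replaces \<open>z1, z2\<close> by vectors \<open>y1, y2\<close> that are orthogonal and still have
  area \<open>D\<close>; therefore \<open>y2\<close> is \<open>i y1\<close> divided by \<open>t\<^sup>2 = |y1|\<^sup>2 / D\<close>. The degree 0 part of \<open>q\<close> scales
  \<open>y1\<close> to \<open>t\<close> and simultaneously \<open>2 D\<close> to \<open>2\<close>. Its degree 2 part, with parameter \<open>y\<close>, adds to
  the entry (1,1) a real multiple of the entry (3,1) divided by \<open>i\<close>.\<close>

lemma gauge_normalizes:
  fixes z1 z2 a w1 w2 :: complex and p u :: real
  assumes c: "c^2 = 1" and D_def: "D = Im (cnj z1 * z2)" and D: "0 < D"
    and coords: "\<And>e x1 x2. \<alpha> (elt c e x1 x2) = su_el (of_real e * a) (of_real x1 * z1 + of_real x2 * z2)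
       (of_real x1 * w1 + of_real x2 * w2) (e * (2 * D)) (e * u)"
  obtains g q t where "gauge c g q" "0 < t" "c = 1 \<Longrightarrow> 1 \<le> t"
    "c * t^2 + 1 / t^2 = (c * (cmod z1)^2 + (cmod z2)^2) / D"
    "\<And>e x1 x2. transform g q \<alpha> (elt c e x1 x2) $ 2 $ 1 = Complex (t * x1) (x2 / t)"
    "\<And>e x1 x2. transform g q \<alpha> (elt c e x1 x2) $ 3 $ 1 = 2 * of_real e * \<i>"
    "\<And>e x1 x2. Re (transform g q \<alpha> (elt c e x1 x2) $ 1 $ 1) = 0"
proof -
  define P Q S where "P = (cmod z1)^2" and "Q = Re (cnj z1 * z2)" and "S = (cmod z2)^2"
  have PS: "P * S = D^2 + Q^2"
    unfolding P_def Q_def S_def D_def cmod_power2 by simp algebra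
  have "z1 \<noteq> 0" "z2 \<noteq> 0" using D D_def by auto
  then have "0 < P" "0 < S" "Q^2 < P * S" using D by (simp_all add: PS) (simp_all add: P_def S_def)
  from diagonalize_pair[OF c this] obtain m n where mn: "m^2 + c * n^2 = 1"
    "Q * (m^2 - c * n^2) + (S - c * P) * m * n = 0"
    "c = 1 \<Longrightarrow> P * n^2 - 2 * Q * m * n + S * m^2 \<le> P * m^2 + 2 * Q * m * n + S * n^2"
    by metis
  define y1 where "y1 = of_real m * z1 + of_real n * z2"
  define y2 where "y2 = of_real m * z2 - of_real (c * n) * z1"
  have P': "(cmod y1)^2 = P * m^2 + 2 * Q * m * n + S * n^2"
    unfolding y1_def P_def Q_def S_def cmod_power2 by simp algebra
  have S': "(cmod y2)^2 = c^2 * P * n^2 - 2 * c * Q * m * n + S * m^2"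
    unfolding y2_def P_def Q_def S_def cmod_power2 by simp algebra
  have "Re (cnj y1 * y2) = Q * (m^2 - c * n^2) + (S - c * P) * m * n"
    unfolding y1_def y2_def P_def Q_def S_def cmod_power2 by simp algebra
  moreover have "Im (cnj y1 * y2) = (m^2 + c * n^2) * D"
    by (simp add: y1_def y2_def D_def power2_eq_square algebra_simps)
  ultimately have cnj_y: "cnj y1 * y2 = of_real D * \<i>"
    by (simp add: complex_eq_iff mn)
  have "y1 \<noteq> 0" using cnj_y D by auto
  define t where "t = cmod y1 / sqrt D"
  have t: "0 < t" "t^2 = (cmod y1)^2 / D"
    using \<open>y1 \<noteq> 0\<close> D by (simp_all add: t_def power_divide)
  have "cmod y1 * cmod y2 = D" using arg_cong[OF cnj_y, of cmod] D by (simp add: norm_mult)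
  then have y12: "(cmod y1)^2 * (cmod y2)^2 = D^2" by (simp flip: power_mult_distrib)
  have y2: "y2 = \<i> * y1 / of_real (t^2)"
  proof -
    have "of_real (D * t^2) = y1 * cnj y1"
      using t D by (simp add: complex_norm_square del: of_real_power of_real_mult)
    then have "of_real D * (of_real (t^2) * y2) = y1 * (cnj y1 * y2)" by (simp add: mult_ac)
    also have "\<dots> = of_real D * (\<i> * y1)" by (simp add: cnj_y)
    finally show ?thesis using D t(1) by (simp add: field_simps)
  qed
  have inv_t2: "1 / t^2 = (cmod y2)^2 / D"
  proof -
    have "D * t^2 = (cmod y1)^2" using t D by simp
    with y12 have "D * t^2 * (cmod y2)^2 = D^2" by simp
    then have "D * (t^2 * (cmod y2)^2) = D * D" by (simp only: power2_eq_square mult.assoc)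
    then have "t^2 * (cmod y2)^2 = D" using D by simp
    then show ?thesis using t(1) D by (simp add: field_simps)
  qed
  have "c * (cmod y1)^2 + (cmod y2)^2 = (c * m^2 + c^2 * n^2) * P + (c * n^2 + m^2) * S"
    by (simp add: P' S' algebra_simps)
  also have "c * m^2 + c^2 * n^2 = c" using mn(1) by algebra
  also have "c * n^2 + m^2 = 1" using mn(1) by simp
  finally have param: "c * t^2 + 1 / t^2 = (c * (cmod z1)^2 + (cmod z2)^2) / D"
    unfolding inv_t2 unfolding t(2)
    by (simp only: P_def S_def mult_1 times_divide_eq_right add_divide_distrib[symmetric])
  have t1: "1 \<le> t" if "c = 1"
  proof -
    have "1 / t^2 \<le> t^2"
      unfolding inv_t2 unfolding t(2) using mn(3) that D by (simp add: P' S' divide_right_mono)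
    then have "1 \<le> t^4" using t(1) by (simp add: field_simps flip: power_add)
    then show ?thesis using t(1) power_less_one_iff[of t 4] by (meson linorder_not_le less_imp_le zero_less_numeral)
  qed
  obtain b where b: "b \<noteq> 0" "b^2 * (y1 / of_real t) = cnj b"
    using scale_to_one[of "y1 / of_real t"] \<open>y1 \<noteq> 0\<close> t(1) by auto
  have "(cmod b)^2 * (cmod y1 / t) = cmod b"
    using arg_cong[OF b(2), of cmod] t(1) by (simp add: norm_mult norm_power norm_divide)
  then have "cmod b * (cmod b * (cmod y1 / t)) = cmod b * 1"
    by (simp only: power2_eq_square mult.assoc mult_1_right)
  then have "cmod b * (cmod y1 / t) = 1" using b(1) by (simp only: mult_left_cancel norm_eq_zero simp_thms)
  then have "(cmod b)^2 * ((cmod y1)^2 / t^2) = 1"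
    by (metis power_mult_distrib power_one power_divide)
  then have bD: "(cmod b)^2 * D = 1" using t D \<open>y1 \<noteq> 0\<close> by simp
  then have bD': "b * cnj b * of_real D = 1"
    by (metis complex_norm_square of_real_1 of_real_mult)
  have by1: "b * b * y1 = of_real t * cnj b"
    using b(2) t(1) by (simp add: power2_eq_square field_simps)
  (* conjugation by the unipotent factor of q adds 2 y e to the entry (1,1) *)
  define y where "y = - Re a / 2"
  define g :: rmat where "g = vector [vector [m, n, 0], vector [- c * n, m, 0], vector [0, 0, 1]]"
  define g' :: rmat where "g' = vector [vector [m, - n, 0], vector [c * n, m, 0], vector [0, 0, 1]]"
  define q :: cmat where "q = vector [vector [b, 0, \<i> * of_real y * b],
    vector [0, cnj b / b, 0], vector [0, 0, 1 / cnj b]]"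
  define q' :: cmat where "q' = vector [vector [1 / b, 0, - \<i> * of_real y * cnj b],
    vector [0, b / cnj b, 0], vector [0, 0, cnj b]]"
  have mnc: "m * m + c * (n * n) = 1" using mn(1) by (simp add: power2_eq_square)
  have inv_g: "matrix_inv g = g'"
    by (rule matrix_inv_unique)
       (use mnc in \<open>simp_all add: g_def g'_def mat3_eq_iff mult3_entry mat_def algebra_simps\<close>)
  have inv_g': "matrix_inv g' = g"
    by (rule matrix_inv_unique)
       (use mnc in \<open>simp_all add: g_def g'_def mat3_eq_iff mult3_entry mat_def algebra_simps\<close>)
  have inv_q: "matrix_inv q = q'"
    by (rule matrix_inv_unique)
       (use b(1) in \<open>simp_all add: q_def q'_def mat3_eq_iff mult3_entry mat_def field_simps\<close>)
  have inv_q': "matrix_inv q' = q"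
    by (rule matrix_inv_unique)
       (use b(1) in \<open>simp_all add: q_def q'_def mat3_eq_iff mult3_entry mat_def field_simps\<close>)
  have "g \<in> Ggrp c"
  proof -
    have "c = 1 \<or> c = - 1" using c by (simp add: power2_eq_1_iff)
    then show ?thesis
      using mnc by (auto simp: Ggrp_def g_def det_3 mat3_eq_iff mult3_entry form_def transpose_def algebra_simps)
  qed
  moreover have "g ** hsym = hsym ** g"
    by (simp add: g_def hsym_def mat3_eq_iff mult3_entry)
  moreover have "q \<in> Pgrp"
  proof -
    have "herm (q *v x) (q *v x') = herm x x'" for x x'
      using b(1) by (simp add: herm_def matrix_vector_mult_def sum_3 q_def field_simps)
    then show ?thesis using b(1) by (simp add: Pgrp_iff SU21_def det_3 q_def)
  qed
  moreover have "q ** iota hsym = iota hsym ** q"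
    by (simp add: q_def iota_simps mat3_eq_iff mult3_entry)
  ultimately have G: "gauge c g q" by (simp add: gauge_def)
  have Ad_g: "Ad g' (elt c e x1 x2) = elt c e (m * x1 - c * n * x2) (n * x1 + m * x2)" for e x1 x2
  proof -
    have "Ad g' (elt c e x1 x2) \<in> liealg c"
      using Ad_liealg[OF c \<open>g \<in> Ggrp c\<close>] by (simp add: inv_g)
    moreover have "Ad g' (elt c e x1 x2) $ 1 $ 2 = (m * m + c * (n * n)) * e"
      "Ad g' (elt c e x1 x2) $ 3 $ 1 = m * x1 - c * n * x2" "Ad g' (elt c e x1 x2) $ 3 $ 2 = n * x1 + m * x2"
      unfolding Ad_def inv_g' by (simp_all add: mult3_entry g_def g'_def algebra_simps)
    ultimately show ?thesis
      by (auto elim!: liealgE simp: mnc)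
  qed
  have tr: "transform g q \<alpha> (elt c e x1 x2) = q' ** su_el (of_real e * a)
      (of_real x1 * y1 + of_real x2 * y2)
      (of_real (m * x1 - c * n * x2) * w1 + of_real (n * x1 + m * x2) * w2)
      (e * (2 * D)) (e * u) ** q" for e x1 x2
    unfolding transform_def inv_g inv_q Ad_g coords
    unfolding Ad_def inv_q' y1_def y2_def by (simp add: algebra_simps)
  show thesis
  proof (rule that[OF G t(1) t1 param])
    fix e x1 x2
    have "transform g q \<alpha> (elt c e x1 x2) $ 2 $ 1
        = (b * b * y1) / cnj b * (of_real x1 + \<i> * of_real x2 / of_real (t^2))"
      using b(1) t(1) unfolding tr y2 by (simp add: mult3_entry q_def q'_def field_simps)
    also have "\<dots> = Complex (t * x1) (x2 / t)"
      using b(1) t(1) unfolding by1 by (simp add: complex_eq_iff power2_eq_square)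
    finally show "transform g q \<alpha> (elt c e x1 x2) $ 2 $ 1 = Complex (t * x1) (x2 / t)" .
    have "transform g q \<alpha> (elt c e x1 x2) $ 3 $ 1 = 2 * (b * cnj b * of_real D) * of_real e * \<i>"
      unfolding tr by (simp add: mult3_entry q_def q'_def)
    then show "transform g q \<alpha> (elt c e x1 x2) $ 3 $ 1 = 2 * of_real e * \<i>"
      by (simp add: bD')
    have "transform g q \<alpha> (elt c e x1 x2) $ 1 $ 1
        = of_real e * a + 2 * (b * cnj b * of_real D) * of_real y * of_real e"
      using b(1) unfolding tr by (simp add: mult3_entry q_def q'_def field_simps)
    then show "Re (transform g q \<alpha> (elt c e x1 x2) $ 1 $ 1) = 0"
      unfolding bD' by (simp add: y_def)
  qed
qed

section \<open>Normality determines the remaining entries\<close>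

text \<open>In terms of \<open>W1 = w1 / t\<close> and \<open>W2 = t w2\<close> the composition of \<open>\<alpha>\<close> with the inverse of the induced
  isomorphism onto \<open>su21 / parab\<close> has a formula free of \<open>t\<close>: the class of \<open>(z, p)\<close> goes to the element with \<open>w = Re z W1 + Im z W2\<close>. The normality
  condition is evaluated at the basis elements \<open>z = 1\<close>, \<open>z = i\<close>, \<open>p = 1\<close>. The first two
  (degree 1 components) and the (1,1) entry of the third give the linear system for \<open>W1, W2, r\<close>, whose
  solution depends on \<open>1 / t\<^sup>2\<close> and \<open>c t\<^sup>2\<close> only; the degree 2 component of the third gives \<open>u\<close>.\<close>

lemma normal_unique:
  assumes c: "c^2 = 1" and t: "0 < t" and ext: "extension c \<alpha>" and nor: "normal_ext c \<alpha>"
    and e21: "\<And>e x1 x2. \<alpha> (elt c e x1 x2) $ 2 $ 1 = Complex (t * x1) (x2 / t)"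
    and e31: "\<And>e x1 x2. \<alpha> (elt c e x1 x2) $ 3 $ 1 = 2 * of_real e * \<i>"
    and e11: "\<And>e x1 x2. Re (\<alpha> (elt c e x1 x2) $ 1 $ 1) = 0"
    and Y: "Y \<in> liealg c"
  shows "\<alpha> Y = alpha_nf c t Y"
proof -
  obtain a z1 z2 w1 w2 p u where
    co: "\<And>e x1 x2. \<alpha> (elt c e x1 x2) = su_el (of_real e * a) (of_real x1 * z1 + of_real x2 * z2)
       (of_real x1 * w1 + of_real x2 * w2) (e * p) (e * u)"
    using extension_coords[OF ext] by metis
  define r where "r = Im a"
  have a: "a = of_real r * \<i>" using e11[of 1 0 0] by (simp add: co r_def complex_eq_iff)
  have z1: "z1 = of_real t" using e21[of 0 1 0] by (simp add: co complex_eq_iff)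
  have z2: "z2 = of_real (1 / t) * \<i>" using e21[of 0 0 1] by (simp add: co complex_eq_iff)
  have p: "p = 2" using e31[of 1 0 0] by (simp add: co complex_eq_iff)
  define W1 where "W1 = w1 / of_real t"
  define W2 where "W2 = w2 * of_real t"
  have w: "w1 = of_real t * W1" "w2 = of_real (1 / t) * W2" using t by (simp_all add: W1_def W2_def)
  have coords: "\<alpha> (elt c e x1 x2) = su_el (of_real (e * r) * \<i>) (Complex (t * x1) (x2 / t))
       (of_real (t * x1) * W1 + of_real (x2 / t) * W2) (2 * e) (e * u)" for e x1 x2
    by (simp add: co a z1 z2 p w complex_eq_iff)
  have corep: "corep c \<alpha> (su_el b z w p v) = elt c (p / 2) (Re z / t) (t * Im z)" for b z w p v
    by (rule corep_eqI[OF ext]) (use t in \<open>simp_all add: coords su_el_diff complex_eq_iff\<close>)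
  have kq: "kappa_quot c \<alpha> (su_el b z w p v) (su_el b' z' w' p' v')
    = lb (su_el (of_real (p / 2 * r) * \<i>) z (of_real (Re z) * W1 + of_real (Im z) * W2) p (p / 2 * u))
         (su_el (of_real (p' / 2 * r) * \<i>) z' (of_real (Re z') * W1 + of_real (Im z') * W2) p' (p' / 2 * u))
      - su_el (of_real (Im (z * cnj z') * r) * \<i>)
         (Complex (c * t^2 * (p * Im z' - p' * Im z) / 2) ((p' * Re z - p * Re z') / (2 * t^2)))
         (of_real (c * t^2 * (p * Im z' - p' * Im z) / 2) * W1 + of_real ((p' * Re z - p * Re z') / (2 * t^2)) * W2)
         (2 * Im (z * cnj z')) (Im (z * cnj z') * u)"
    for b z w p v b' z' w' p' v'
  proof -
    have E: "t * Im z * (Re z' / t) - Re z / t * (t * Im z') = Im (z * cnj z')"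
      using t by (simp add: field_simps)
    have E1: "t * (c * (p / 2 * (t * Im z') - p' / 2 * (t * Im z))) = c * t^2 * (p * Im z' - p' * Im z) / 2"
      by (simp add: power2_eq_square algebra_simps)
    have E2: "(p' / 2 * (Re z / t) - p / 2 * (Re z' / t)) / t = (p' * Re z - p * Re z') / (2 * t^2)"
      using t by (simp add: power2_eq_square field_simps)
    have cc: "Complex (t * (Re y / t)) (t * Im y / t) = y" for y using t by (simp add: complex_eq_iff)
    have q: "t * (y / t) = y" "t * y / t = y" for y using t by simp_all
    show ?thesis
      unfolding kappa_quot_def corep kappa_def lb_elt[OF c] coords E E1 E2 cc q
      by (simp only: mult_2 field_sum_of_halves complex_surj)
  qed
  define X where "X = (\<lambda>k::3. if k = 1 then su_el 0 1 0 0 0 else if k = 2 then su_el 0 \<i> 0 0 0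
    else su_el 0 0 0 1 0)"
  define Z where "Z = (\<lambda>k::3. if k = 1 then su_el 0 0 (- 1 / 2) 0 0
    else if k = 2 then su_el 0 0 (- \<i> / 2) 0 0 else su_el 0 0 0 0 (- 1))"
  have "dual_bases X Z"
    by (simp add: dual_bases_def X_def Z_def forall_3 trace_su_el)
  then have N: "(\<Sum>k\<in>UNIV. kappa_quot c \<alpha> (lb (Z k) (X j)) (X k))
      = 2 *\<^sub>R (\<Sum>k\<in>UNIV. lb (Z k) (kappa_quot c \<alpha> (X j) (X k)))" for j
    using nor unfolding normal_ext_def dual_bases_def by blast
  note N1 = N[of 1, unfolded sum_3 X_def Z_def, simplified,
    unfolded lb_su_el kq su_el_diff su_el_add su_el_scaleR su_el_eq_iff, simplified]
  note N2 = N[of 2, unfolded sum_3 X_def Z_def, simplified,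
    unfolded lb_su_el kq su_el_diff su_el_add su_el_scaleR su_el_eq_iff, simplified]
  note N3 = N[of 3, unfolded sum_3 X_def Z_def, simplified,
    unfolded lb_su_el kq su_el_diff su_el_add su_el_scaleR su_el_eq_iff, simplified]
  define k where "k = 1 / t^2"
  have half_k: "1 / (2 * t^2) = k / 2" "2 * Im W2 / t^2 = 2 * k * Im W2" by (simp_all add: k_def)
  note R = N1 N2 N3[THEN conjunct1]
  have R1: "5 * Re W1 + 3 * Im W2 = k" "Re W2 = 3 * Im W1"
    using R(1) unfolding half_k complex_eq_iff by (simp_all add: field_simps)
  have R2: "3 * Re W1 + 5 * Im W2 = c * t^2" "Im W1 = 3 * Re W2"
    using R(2) unfolding half_k complex_eq_iff by (simp_all add: field_simps)
  have R3: "8 * r = k + c * t^2"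
    using R(3) unfolding half_k complex_eq_iff by (simp add: field_simps)
  have W: "Im W1 = 0" "Re W2 = 0" "r = (k + c * t^2) / 8"
    "Re W1 = (5 * k - 3 * (c * t^2)) / 16" "Im W2 = (5 * (c * t^2) - 3 * k) / 16"
  proof -
    show "Im W1 = 0" "Re W2 = 0" using R1(2) R2(2) by simp_all
    show "r = (k + c * t^2) / 8" using R3 by simp
    have "16 * Re W1 = 5 * (5 * Re W1 + 3 * Im W2) - 3 * (3 * Re W1 + 5 * Im W2)"
      "16 * Im W2 = 5 * (3 * Re W1 + 5 * Im W2) - 3 * (5 * Re W1 + 3 * Im W2)" by simp_all
    then show "Re W1 = (5 * k - 3 * (c * t^2)) / 16" "Im W2 = (5 * (c * t^2) - 3 * k) / 16"
      unfolding R1 R2 by simp_all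
  qed
  have U: "3 * u = 2 * (Re W1 * Im W2 - Re W2 * Im W1) + k * Im W2 + c * t^2 * Re W1
      - 3 * r * (Re W1 + Im W2)"
    using N3[THEN conjunct2, THEN conjunct2] unfolding half_k by (simp add: field_simps)
  have u: "u = - (15 * (c * t^2)^2 - 34 * (c * t^2) * k + 15 * k^2) / 128"
    using U unfolding W by (simp add: field_simps power2_eq_square)
  obtain e x1 x2 where Y: "Y = elt c e x1 x2" using Y by (rule liealgE)
  show ?thesis
    using t c unfolding Y coords alpha_nf_elt su_el_eq_iff u W(3)
    by (simp add: complex_eq_iff W k_def) (simp add: field_simps power_numeral_reduce)
qed

section \<open>Classification\<close>

lemma gauge_to_alpha_nf:
  assumes c: "c^2 = 1" and ext: "extension c \<alpha>" and nor: "normal_ext c \<alpha>"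
    and D: "D = Im (cnj z1 * z2)" "0 < D"
    and coords: "\<And>e x1 x2. \<alpha> (elt c e x1 x2) = su_el (of_real e * a) (of_real x1 * z1 + of_real x2 * z2)
       (of_real x1 * w1 + of_real x2 * w2) (e * (2 * D)) (e * u)"
  obtains g q t where "gauge c g q" "0 < t" "c = 1 \<Longrightarrow> 1 \<le> t"
    "c * t^2 + 1 / t^2 = (c * (cmod z1)^2 + (cmod z2)^2) / D"
    "\<And>X. X \<in> liealg c \<Longrightarrow> alpha_nf c t X = transform g q \<alpha> X"
proof -
  obtain g q t where G: "gauge c g q" and t: "0 < t" "c = 1 \<Longrightarrow> 1 \<le> t"
    and param: "c * t^2 + 1 / t^2 = (c * (cmod z1)^2 + (cmod z2)^2) / D"
    and entries: "\<And>e x1 x2. transform g q \<alpha> (elt c e x1 x2) $ 2 $ 1 = Complex (t * x1) (x2 / t)"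
    "\<And>e x1 x2. transform g q \<alpha> (elt c e x1 x2) $ 3 $ 1 = 2 * of_real e * \<i>"
    "\<And>e x1 x2. Re (transform g q \<alpha> (elt c e x1 x2) $ 1 $ 1) = 0"
    using gauge_normalizes[OF c D coords] by metis
  have "transform g q \<alpha> X = alpha_nf c t X" if "X \<in> liealg c" for X
    by (rule normal_unique[OF c t(1) extension_transform[OF c G ext] normal_transform[OF c G ext nor]
          entries that])
  with G t param show thesis by (intro that) auto
qed

lemma classification:
  assumes c: "c^2 = 1" and \<alpha>: "regular_normal_extension c \<alpha>"
  obtains t where "0 < t" "c = 1 \<Longrightarrow> 1 \<le> t" "equivalent c \<alpha> (alpha_nf c t)"
    "0 < bdet c \<alpha> \<Longrightarrow> c * t^2 + 1 / t^2 = param c \<alpha>"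
proof -
  have ext: "extension c \<alpha>" and reg: "regular c \<alpha>" and nor: "normal_ext c \<alpha>"
    using \<alpha> by (auto simp: regular_normal_extension_def)
  obtain a z1 z2 w1 w2 p u where
    co: "\<And>e x1 x2. \<alpha> (elt c e x1 x2) = su_el (of_real e * a) (of_real x1 * z1 + of_real x2 * z2)
       (of_real x1 * w1 + of_real x2 * w2) (e * p) (e * u)" and ne: "Im (cnj z1 * z2) \<noteq> 0"
    using extension_coords[OF ext] by metis
  define D where "D = Im (cnj z1 * z2)"
  have p: "p = 2 * D" using regular_coords[OF c ext reg co] by (simp add: D_def)
  have bdet: "bdet c \<alpha> = D" by (simp add: bdet_def co D_def algebra_simps)
  have param: "param c \<alpha> = (c * (cmod z1)^2 + (cmod z2)^2) / D"
    by (simp add: param_def bdet co cmod_power2 algebra_simps)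
  show thesis
  proof (cases "0 < D")
    case True
    obtain g q t where "gauge c g q" "0 < t" "c = 1 \<Longrightarrow> 1 \<le> t"
      "c * t^2 + 1 / t^2 = (c * (cmod z1)^2 + (cmod z2)^2) / D"
      "\<And>X. X \<in> liealg c \<Longrightarrow> alpha_nf c t X = transform g q \<alpha> X"
      using gauge_to_alpha_nf[OF c ext nor D_def True co[unfolded p]] by metis
    then show thesis
      by (intro that[of t]) (auto simp: param intro: equivalent_transform)
  next
    case False
    then have D: "0 < - D" using ne by (simp add: D_def)
    (* Ad f reverses the orientation of the plane e = 0: (e, x1, x2) goes to (-e, x1, -x2). *)
    define f :: rmat where "f = vector [vector [- 1, 0, 0], vector [0, 1, 0], vector [0, 0, - 1]]"
    have inv_f: "matrix_inv f = f"
      by (rule matrix_inv_unique) (simp_all add: f_def mat3_eq_iff mult3_entry mat_def)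
    have "f \<in> Ggrp c"
      by (simp add: Ggrp_def f_def det_3 mat3_eq_iff mult3_entry form_def transpose_def)
    moreover have "f ** hsym = hsym ** f" by (simp add: f_def hsym_def mat3_eq_iff mult3_entry)
    moreover have "mat 1 \<in> Pgrp" by (simp add: Pgrp_iff SU21_def) (simp add: mat_def)
    ultimately have F: "gauge c f (mat 1)" by (simp add: gauge_def)
    have Ad_f: "Ad f (elt c e x1 x2) = elt c (- e) x1 (- x2)" for e x1 x2
      unfolding Ad_def inv_f by (simp add: f_def mat3_eq_iff mult3_entry)
    have co': "transform f (mat 1) \<alpha> (elt c e x1 x2) = su_el (of_real e * (- a))
        (of_real x1 * z1 + of_real x2 * (- z2)) (of_real x1 * w1 + of_real x2 * (- w2))
        (e * (2 * (- D))) (e * (- u))" for e x1 x2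
      by (simp add: transform_def inv_f Ad_f matrix_inv_simps co p)
    have D': "- D = Im (cnj z1 * (- z2))" by (simp add: D_def)
    obtain g q t where gq: "gauge c g q" "0 < t" "c = 1 \<Longrightarrow> 1 \<le> t"
      "\<And>X. X \<in> liealg c \<Longrightarrow> alpha_nf c t X = transform g q (transform f (mat 1) \<alpha>) X"
      using gauge_to_alpha_nf[OF c extension_transform[OF c F ext] normal_transform[OF c F ext nor]
          D' D co'] by metis
    have "gauge c (g ** f) q"
      using gauge_mult[OF gq(1) F] by simp
    then have "equivalent c \<alpha> (alpha_nf c t)"
      by (rule equivalent_transform) (simp add: gq(4) transform_transform[OF gq(1) F])
    then show thesis using gq(2,3) False bdet by (intro that[of t]) auto
  qed
qed

section \<open>The parameters s and t\<close>

text \<open>In both cases \<open>t\<^sup>2\<close> is a root of the quadratic equation in \<open>t\<^sup>2\<close> equivalent to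
  \<open>s = c t\<^sup>2 + 1 / t\<^sup>2\<close>: the larger one if \<open>c = 1\<close>, where the product of the roots is \<open>1\<close>, and the
  positive one if \<open>c = -1\<close>, where the product is \<open>-1\<close>.\<close>

lemma t_so3_props:
  assumes "2 \<le> s"
  shows "1 \<le> t_so3 s" "(t_so3 s)^2 + 1 / (t_so3 s)^2 = s"
proof -
  have s2: "0 \<le> s^2 - 4" using power_mono[OF assms, of 2] by simp
  define x where "x = (s + sqrt (s^2 - 4)) / 2"
  have x: "1 \<le> x"
    unfolding x_def using add_mono[OF assms real_sqrt_ge_zero[OF s2]] by simp
  have "x * (s - x) = (s^2 - (sqrt (s^2 - 4))^2) / 4"
    by (simp add: x_def power2_eq_square field_simps)
  then have "x * (s - x) = 1" using s2 by simp
  then have "x + 1 / x = s" using x by (simp add: field_simps)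
  moreover have "t_so3 s = sqrt x" by (simp only: t_so3_def x_def)
  ultimately show "1 \<le> t_so3 s" "(t_so3 s)^2 + 1 / (t_so3 s)^2 = s"
    using x by simp_all
qed

lemma t_so3_eqI:
  assumes "1 \<le> t" shows "t_so3 (t^2 + 1 / t^2) = t" "2 \<le> t^2 + 1 / t^2"
proof -
  have t: "1 / t^2 \<le> 1" "1 \<le> t^2" using assms by (simp_all add: one_le_power)
  have "(t^2 + 1 / t^2)^2 - 4 = (t^2 - 1 / t^2)^2"
    using assms by (simp add: field_simps power2_eq_square)
  then have sq: "sqrt ((t^2 + 1 / t^2)^2 - 4) = t^2 - 1 / t^2" using t by simp
  then show "t_so3 (t^2 + 1 / t^2) = t" using assms by (simp add: t_so3_def)
  have "t^2 + 1 / t^2 - 2 = (t - 1 / t)^2"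
    using assms by (simp add: field_simps power2_eq_square)
  then show "2 \<le> t^2 + 1 / t^2" by (smt (verit) zero_le_power2)
qed

lemma t_so21_props:
  shows "0 < t_so21 s" "1 / (t_so21 s)^2 - (t_so21 s)^2 = s"
proof -
  define x where "x = (s - sqrt (s^2 + 4)) / (- 2)"
  have "\<bar>s\<bar> < sqrt (s^2 + 4)" by (rule real_less_rsqrt) simp
  then have x: "0 < x" by (simp add: x_def)
  have "x * (s + x) = ((sqrt (s^2 + 4))^2 - s^2) / 4"
    by (simp only: x_def power2_eq_square) (simp add: field_simps)
  then have "x * (s + x) = 1" by simp
  then have "1 / x - x = s" using x by (simp add: field_simps)
  moreover have "t_so21 s = sqrt x" by (simp only: t_so21_def x_def)
  ultimately show "0 < t_so21 s" "1 / (t_so21 s)^2 - (t_so21 s)^2 = s"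
    using x by simp_all
qed

lemma t_so21_eqI:
  assumes "0 < t" shows "t_so21 (1 / t^2 - t^2) = t"
proof -
  have "(1 / t^2 - t^2)^2 + 4 = (1 / t^2 + t^2)^2"
    using assms by (simp add: field_simps power2_eq_square)
  then have "sqrt ((1 / t^2 - t^2)^2 + 4) = 1 / t^2 + t^2" by simp
  then show ?thesis using assms by (simp add: t_so21_def)
qed

lemma bdet_alpha_nf: "t \<noteq> 0 \<Longrightarrow> bdet c (alpha_nf c t) = 1"
  by (simp add: bdet_def alpha_nf_elt)

lemma param_alpha_nf: "t \<noteq> 0 \<Longrightarrow> param c (alpha_nf c t) = c * t^2 + 1 / t^2"
  by (simp add: param_def bdet_alpha_nf) (simp add: alpha_nf_elt power_divide)

theorem theorem4p3:
  shows
    "(\<forall>s\<ge>2. regular_normal_extension 1 (alpha_so3 (t_so3 s)) \<and>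
        0 < bdet 1 (alpha_so3 (t_so3 s)) \<and> param 1 (alpha_so3 (t_so3 s)) = s \<and>
        (\<forall>e x1 x2 h y1 y2. kappa (alpha_so3 (t_so3 s)) (elt 1 e x1 x2) (elt 1 h y1 y2)
           = kappa_nf (t_so3 s) e x1 x2 h y1 y2)) \<and>
     (\<forall>\<alpha>. regular_normal_extension 1 \<alpha> \<longrightarrow>
        (\<exists>s\<ge>2. equivalent 1 \<alpha> (alpha_so3 (t_so3 s))) \<and>
        (0 < bdet 1 \<alpha> \<longrightarrow>
           2 \<le> param 1 \<alpha> \<and> equivalent 1 \<alpha> (alpha_so3 (t_so3 (param 1 \<alpha>))))) \<and>
     (\<forall>s. regular_normal_extension (- 1) (alpha_so21 (t_so21 s)) \<and>
        0 < bdet (- 1) (alpha_so21 (t_so21 s)) \<and> param (- 1) (alpha_so21 (t_so21 s)) = s \<and>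
        (\<forall>e x1 x2 h y1 y2. kappa (alpha_so21 (t_so21 s)) (elt (- 1) e x1 x2) (elt (- 1) h y1 y2)
           = kappa_nf (t_so21 s) e x1 x2 h y1 y2)) \<and>
     (\<forall>\<alpha>. regular_normal_extension (- 1) \<alpha> \<longrightarrow>
        (\<exists>s. equivalent (- 1) \<alpha> (alpha_so21 (t_so21 s))) \<and>
        (0 < bdet (- 1) \<alpha> \<longrightarrow>
           equivalent (- 1) \<alpha> (alpha_so21 (t_so21 (param (- 1) \<alpha>)))))"
proof (intro conjI allI impI)
  fix s :: real assume s: "2 \<le> s"
  then have t: "t_so3 s \<noteq> 0" using t_so3_props(1)[OF s] by auto
  show "regular_normal_extension 1 (alpha_so3 (t_so3 s))"
    using t by (simp add: alpha_so3_eq regular_normal_alpha_nf)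
  show "0 < bdet 1 (alpha_so3 (t_so3 s))" using t by (simp add: alpha_so3_eq bdet_alpha_nf)
  show "param 1 (alpha_so3 (t_so3 s)) = s"
    using t t_so3_props(2)[OF s] by (simp add: alpha_so3_eq param_alpha_nf)
  show "kappa (alpha_so3 (t_so3 s)) (elt 1 e x1 x2) (elt 1 h y1 y2)
      = kappa_nf (t_so3 s) e x1 x2 h y1 y2" for e x1 x2 h y1 y2
    using t by (simp add: alpha_so3_eq kappa_alpha_nf)
next
  fix \<alpha> assume \<alpha>: "regular_normal_extension 1 \<alpha>"
  obtain t where t: "1 \<le> t" "equivalent 1 \<alpha> (alpha_nf 1 t)"
    "0 < bdet 1 \<alpha> \<Longrightarrow> t^2 + 1 / t^2 = param 1 \<alpha>"
    using classification[OF _ \<alpha>] by auto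
  show "\<exists>s\<ge>2. equivalent 1 \<alpha> (alpha_so3 (t_so3 s))"
    using t(2) t_so3_eqI[OF t(1)] by (auto simp: alpha_so3_eq intro!: exI[of _ "t^2 + 1 / t^2"])
  assume "0 < bdet 1 \<alpha>"
  with t(3) t(2) t_so3_eqI[OF t(1)]
  show "2 \<le> param 1 \<alpha>" "equivalent 1 \<alpha> (alpha_so3 (t_so3 (param 1 \<alpha>)))"
    by (auto simp: alpha_so3_eq)
next
  fix s :: real
  have t: "t_so21 s \<noteq> 0" using t_so21_props(1)[of s] by auto
  show "regular_normal_extension (- 1) (alpha_so21 (t_so21 s))"
    using t by (simp add: alpha_so21_eq regular_normal_alpha_nf)
  show "0 < bdet (- 1) (alpha_so21 (t_so21 s))" using t by (simp add: alpha_so21_eq bdet_alpha_nf)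
  show "param (- 1) (alpha_so21 (t_so21 s)) = s"
    using t t_so21_props(2)[of s] by (simp add: alpha_so21_eq param_alpha_nf)
  show "kappa (alpha_so21 (t_so21 s)) (elt (- 1) e x1 x2) (elt (- 1) h y1 y2)
      = kappa_nf (t_so21 s) e x1 x2 h y1 y2" for e x1 x2 h y1 y2
    using t by (simp add: alpha_so21_eq kappa_alpha_nf)
next
  fix \<alpha> assume \<alpha>: "regular_normal_extension (- 1) \<alpha>"
  obtain t where t: "0 < t" "equivalent (- 1) \<alpha> (alpha_nf (- 1) t)"
    "0 < bdet (- 1) \<alpha> \<Longrightarrow> 1 / t^2 - t^2 = param (- 1) \<alpha>"
    using classification[OF _ \<alpha>] by auto
  show "\<exists>s. equivalent (- 1) \<alpha> (alpha_so21 (t_so21 s))"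
    using t(2) t_so21_eqI[OF t(1)] by (auto simp: alpha_so21_eq intro!: exI[of _ "1 / t^2 - t^2"])
  assume "0 < bdet (- 1) \<alpha>"
  with t(3) t(2) t_so21_eqI[OF t(1)]
  show "equivalent (- 1) \<alpha> (alpha_so21 (t_so21 (param (- 1) \<alpha>)))"
    by (auto simp: alpha_so21_eq)
qed

end
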